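(* Let $S$ be a real-analytic function on a neighborhood of the origin in $\mathbb{R}^n$, not identically zero, with $S(0)=0$ and $\nabla S(0)=0$. Let $d$ be its Newton distance, $C(S)$ its central face and $k=\dim C(S)$, and suppose that $C(S)$ is a compact face of $N(S)$. There is a neighborhood $U$ of the origin such that for every smooth nonnegative $\phi$ supported in $U$ with $\phi(0)>0$ the following hold. (a) If there is some $x\in(\mathbb{R}-\{0\})^n$ such that the growth index of $|S_{C(S)}|$ at $x$ is $a<\frac1d$, then for some $a'<\frac1d$ and some constant $C>0$ one has $I_{|S|,\phi}(\epsilon) > C\,\epsilon^{a'}$ for all sufficiently small $\epsilon>0$. (b) If there is some $x\in(\mathbb{R}-\{0\})^n$ such that $|S_{C(S)}|$ has growth index $\frac1d$ at $x$, with multiplicity $q$, then for some constant $C>0$ one has $I_{|S|,\phi}(\epsilon) > C\,|\ln\epsilon|^{\,n-k+q}\,\epsilon^{1/d}$ for all sufficiently small $\epsilon>0$.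
   Context: Write the Taylor expansion of $S$ at the origin as $S(x)=\sum_\alpha s_\alpha x^\alpha$. The Newton polyhedron $N(S)$ is the convex hull of the union, over all $\alpha$ with $s_\alpha\neq 0$, of the octants $Q_\alpha=\{x\in\mathbb{R}^n: x_i\ge\alpha_i \text{ for all } i\}$. Its faces can be compact or unbounded; a vertex is a compact face of dimension $0$. For a compact face $F$ of $N(S)$, $S_F(x)=\sum_{\alpha\in F}s_\alpha x^\alpha$. The Newton distance is $d=\inf\{t:(t,\dots,t)\in N(S)\}$. The central face $C(S)$ is the face (compact or not) of $N(S)$ whose relative interior contains $(d,\dots,d)$ (a vertex, with $k=0$, if the line $\{(t,\dots,t)\}$ meets $N(S)$ at a vertex). $I_{|S|,\phi}(\epsilon)=\int_{\{x:|S(x)|<\epsilon\}}\phi(x)\,dx$. Growth index and multiplicity: for a real-analytic $f\not\equiv0$ near $0\in\mathbb{R}^n$ with $f(0)=0$, and smooth $\phi\ge0$ with $\phi(0)>0$ supported in a sufficiently small neighborhood of $0$, the integral $I_{f,\phi}(\epsilon)=\int_{\{0<f(x)<\epsilon\}}\phi(x)\,dx$ has an asymptotic expansion $\sum_{j\ge0}\sum_{i=0}^{n-1}c_{ij}(\phi)(\ln\epsilon)^i\epsilon^{r_j}$ as $\epsilon\to0^+$, with $\{r_j\}$ an increasing arithmetic progression of positive rationals independent of $\phi$. The growth index of $f$ at $0$ is the smallest $r_j$ for which some $c_{ij}(\phi)\ne0$, and its multiplicity is the largest $i$ with $c_{ij}(\phi)\neq0$ for this $j$ (both are independent of $\phi$;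 the index is $+\infty$ if all coefficients vanish). The growth index of $|f|$ at $0$ is the minimum of the growth indices of $f$ and $-f$; its multiplicity is the multiplicity for whichever of $f,-f$ attains the minimum, and the maximum of the two multiplicities if both attain it. The growth index of $|f|$ at a point $p$ is that of $x\mapsto|f(x+p)|$ at $x=0$; it is $+\infty$ if $f(p)\ne0$, and it equals $1$ if $f(p)=0$ and $\nabla f(p)\ne0$. *)

theory Defs
  imports "HOL-Analysis.Analysis" "HOL-Library.Landau_Symbols"
begin

text \<open>Multi-indices are functions \<open>'n \<Rightarrow> nat\<close> on the finite index type \<open>'n\<close> of \<open>real ^ 'n\<close>.\<close>

definition monomial_at :: "real ^ 'n::finite \<Rightarrow> ('n \<Rightarrow> nat) \<Rightarrow> real" where
  "monomial_at x \<alpha> = (\<Prod>i\<in>UNIV. (x $ i) ^ \<alpha> i)"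

definition multi_vec :: "('n::finite \<Rightarrow> nat) \<Rightarrow> real ^ 'n" where
  "multi_vec \<alpha> = (\<chi> i. real (\<alpha> i))"

text \<open>Unconditional summability over all multi-indices amounts to absolute convergence of the
  power series. The coefficients \<open>s\<close> are determined by the germ of \<open>f\<close> at \<open>p\<close>.\<close>

definition has_taylor_expansion ::
    "(real ^ 'n::finite \<Rightarrow> real) \<Rightarrow> (('n \<Rightarrow> nat) \<Rightarrow> real) \<Rightarrow> real ^ 'n \<Rightarrow> bool" where
  "has_taylor_expansion f s p \<longleftrightarrow>
     (\<forall>\<^sub>F x in nhds 0. ((\<lambda>\<alpha>. s \<alpha> * monomial_at x \<alpha>) has_sum f (p + x)) UNIV)"

definition real_analytic_on :: "(real ^ 'n::finite \<Rightarrow> real) \<Rightarrow> (real ^ 'n) set \<Rightarrow> bool" where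
  "real_analytic_on f V \<longleftrightarrow> (\<forall>p\<in>V. \<exists>s. has_taylor_expansion f s p)"

fun C_k :: "nat \<Rightarrow> (real ^ 'n::finite \<Rightarrow> real) \<Rightarrow> bool" where
  "C_k 0 f \<longleftrightarrow> continuous_on UNIV f"
| "C_k (Suc k) f \<longleftrightarrow> (\<forall>x. f differentiable (at x)) \<and>
     (\<forall>i. C_k k (\<lambda>x. frechet_derivative f (at x) (axis i 1)))"

definition smooth :: "(real ^ 'n::finite \<Rightarrow> real) \<Rightarrow> bool" where
  "smooth f \<longleftrightarrow> (\<forall>k. C_k k f)"

definition bump_functions :: "(real ^ 'n::finite) set \<Rightarrow> (real ^ 'n \<Rightarrow> real) set" where
  "bump_functions U =
     {\<phi>. smooth \<phi> \<and> (\<forall>x. \<phi> x \<ge> 0) \<and> \<phi> 0 > 0 \<and> closure {x. \<phi> x \<noteq> 0} \<subseteq> U}"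


subsection \<open>The Newton polyhedron\<close>

text \<open>The polyhedron is attached to the Taylor coefficients \<open>s\<close> of the function at the origin.\<close>

definition newton_polyhedron :: "(('n::finite \<Rightarrow> nat) \<Rightarrow> real) \<Rightarrow> (real ^ 'n) set" where
  "newton_polyhedron s =
     convex hull (\<Union>\<alpha>\<in>{\<alpha>. s \<alpha> \<noteq> 0}. {x. \<forall>i. x $ i \<ge> real (\<alpha> i)})"

definition newton_distance :: "(('n::finite \<Rightarrow> nat) \<Rightarrow> real) \<Rightarrow> real" where
  "newton_distance s = Inf {t. vec t \<in> newton_polyhedron s}"

text \<open>A convex set is the disjoint union of the relative interiors of its faces, so this
  determines \<open>F\<close>.\<close>

definition is_central_face :: "(('n::finite \<Rightarrow> nat) \<Rightarrow> real) \<Rightarrow> (real ^ 'n) set \<Rightarrow> bool" where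
  "is_central_face s F \<longleftrightarrow>
     F face_of newton_polyhedron s \<and> vec (newton_distance s) \<in> rel_interior F"

text \<open>For compact \<open>F\<close> the index set is finite; for unbounded \<open>F\<close> the value may be junk.\<close>

definition face_poly ::
    "(('n::finite \<Rightarrow> nat) \<Rightarrow> real) \<Rightarrow> (real ^ 'n) set \<Rightarrow> real ^ 'n \<Rightarrow> real" where
  "face_poly s F x = (\<Sum>\<alpha>\<in>{\<alpha>. multi_vec \<alpha> \<in> F}. s \<alpha> * monomial_at x \<alpha>)"


subsection \<open>Growth index and multiplicity\<close>

definition abs_sublevel_integral ::
    "(real ^ 'n::finite \<Rightarrow> real) \<Rightarrow> (real ^ 'n \<Rightarrow> real) \<Rightarrow> real \<Rightarrow> real" where
  "abs_sublevel_integral f \<phi> \<epsilon> = (LINT x:{x. \<bar>f x\<bar> < \<epsilon>}|lborel. \<phi> x)"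

definition pos_sublevel_integral ::
    "(real ^ 'n::finite \<Rightarrow> real) \<Rightarrow> (real ^ 'n \<Rightarrow> real) \<Rightarrow> real \<Rightarrow> real" where
  "pos_sublevel_integral f \<phi> \<epsilon> = (LINT x:{x. 0 < f x \<and> f x < \<epsilon>}|lborel. \<phi> x)"

definition rational_progression :: "(nat \<Rightarrow> real) \<Rightarrow> bool" where
  "rational_progression r \<longleftrightarrow>
     (\<exists>a\<in>\<rat>. \<exists>b\<in>\<rat>. a > 0 \<and> b > 0 \<and> (\<forall>j. r j = a + real j * b))"

text \<open>\<open>N\<close> is the number of powers of the logarithm allowed at each exponent. For each \<open>J\<close> the
  terms up to exponent \<open>r J\<close> are subtracted, so the remainder is \<open>o\<close> of the power \<open>r J\<close>.\<close>

definition has_log_power_expansion ::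
    "nat \<Rightarrow> (real \<Rightarrow> real) \<Rightarrow> (nat \<Rightarrow> real) \<Rightarrow> (nat \<Rightarrow> nat \<Rightarrow> real) \<Rightarrow> bool" where
  "has_log_power_expansion N g r c \<longleftrightarrow>
     (\<forall>J. (\<lambda>\<epsilon>. g \<epsilon> - (\<Sum>j\<le>J. \<Sum>i<N. c i j * ln \<epsilon> ^ i * \<epsilon> powr r j))
            \<in> o[at_right 0](\<lambda>\<epsilon>. \<epsilon> powr r J))"

text \<open>The multiplicity is meaningless when all coefficients vanish; it is set to \<open>0\<close>.\<close>

definition leading_term ::
    "nat \<Rightarrow> (nat \<Rightarrow> real) \<Rightarrow> (nat \<Rightarrow> nat \<Rightarrow> real) \<Rightarrow> ereal \<Rightarrow> nat \<Rightarrow> bool" where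
  "leading_term N r c a m \<longleftrightarrow>
     (a = \<infinity> \<and> m = 0 \<and> (\<forall>j. \<forall>i<N. c i j = 0)) \<or>
     (\<exists>j. a = ereal (r j) \<and> (\<forall>j'<j. \<forall>i<N. c i j' = 0) \<and>
          m < N \<and> c m j \<noteq> 0 \<and> (\<forall>i<N. m < i \<longrightarrow> c i j = 0))"

text \<open>\<open>has_growth_index f a m\<close>: the growth index of \<open>f\<close> at the origin is \<open>a\<close>, with multiplicity
  \<open>m\<close>. The progression does not depend on the bump function; the coefficients do.\<close>

definition has_growth_index ::
    "(real ^ 'n::finite \<Rightarrow> real) \<Rightarrow> ereal \<Rightarrow> nat \<Rightarrow> bool" where
  "has_growth_index f a m \<longleftrightarrow>
     (\<exists>r U. rational_progression r \<and> open U \<and> 0 \<in> U \<and>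
        (\<forall>\<phi>\<in>bump_functions U. \<exists>c.
           has_log_power_expansion CARD('n) (pos_sublevel_integral f \<phi>) r c \<and>
           leading_term CARD('n) r c a m))"

definition abs_has_growth_index ::
    "(real ^ 'n::finite \<Rightarrow> real) \<Rightarrow> ereal \<Rightarrow> nat \<Rightarrow> bool" where
  "abs_has_growth_index f a m \<longleftrightarrow>
     (\<exists>a1 m1 a2 m2. has_growth_index f a1 m1 \<and> has_growth_index (\<lambda>x. - f x) a2 m2 \<and>
        a = min a1 a2 \<and>
        m = (if a1 < a2 then m1 else if a2 < a1 then m2 else max m1 m2))"

text \<open>That the index is \<open>1\<close> where \<open>f\<close> vanishes with nonzero gradient is a consequence, not a
  separate case.\<close>

definition abs_has_growth_index_at ::
    "(real ^ 'n::finite \<Rightarrow> real) \<Rightarrow> real ^ 'n \<Rightarrow> ereal \<Rightarrow> nat \<Rightarrow> bool" where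
  "abs_has_growth_index_at f p a m \<longleftrightarrow>
     (if f p \<noteq> 0 then a = \<infinity> \<and> m = 0 else abs_has_growth_index (\<lambda>x. f (x + p)) a m)"

end

theory Submission
  imports Defs "HOL-Computational_Algebra.Polynomial"
begin

text \<open>Since \<open>F\<close> is compact, it is exposed by a weight \<open>w\<^sub>0\<close> with positive coordinates, and every
  small perturbation of \<open>w\<^sub>0\<close> orthogonal to the directions of \<open>F\<close> also exposes \<open>F\<close>. Put
  \<open>v = (d, \<dots>, d) \<in> F\<close> and \<open>w = T w\<^sub>0 + u\<close> with \<open>u\<close> in this orthogonal space, of dimension \<open>n - k\<close>, and
  \<open>norm u \<le> r T\<close>. Let \<open>z i = exp (- w i) y i\<close>. Then \<open>S z = exp (- w \<bullet> v) (S\<^sub>F y + O(exp (- T \<eta> / 2)))\<close>.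
  With \<open>T = \<bar>ln \<epsilon>\<bar> / (w\<^sub>0 \<bullet> v + \<eta> / 4)\<close> the error is negligible against \<open>\<delta> = \<epsilon> exp (w \<bullet> v)\<close>, while \<open>\<delta>\<close> is
  still bounded by a positive power of \<open>\<epsilon>\<close>. So \<open>{\<bar>S\<bar> < \<epsilon>}\<close> contains the image under \<open>y \<mapsto> z\<close> of the set
  \<open>{\<bar>S\<^sub>F\<bar> < \<delta> / 2}\<close> near \<open>x\<close>, whose volume is at least a constant times
  \<open>exp (- w \<bullet> v / d) \<bar>ln \<delta>\<bar>\<^sup>q (\<delta> powr a)\<close>. The single weight \<open>w = T w\<^sub>0\<close> gives (a). For (b) each \<open>w\<close>
  contributes \<open>\<bar>ln \<epsilon>\<bar>\<^sup>q (\<epsilon> powr (1 / d))\<close>, and the images are disjoint when \<open>w\<close> runs through a separated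
  set, which can be chosen with at least a constant times \<open>T ^ (n - k)\<close> elements.\<close>

subsection \<open>Smooth bump functions\<close>

text \<open>\<open>C_k\<close> refers to derivatives through the choice operator
  \<open>frechet_derivative\<close>; by uniqueness of derivatives any explicit derivative can take
  its place.\<close>

lemma C_k_SucI:
  assumes "\<And>x. (f has_derivative f' x) (at x)"
    and "\<And>i. C_k k (\<lambda>x. f' x (axis i 1))"
  shows "C_k (Suc k) f"
proof -
  have "frechet_derivative f (at x) = f' x" for x
    using assms(1) frechet_derivative_at by metis
  then show ?thesis
    using assms by (auto simp: differentiable_def)
qed

lemma C_k_Suc_imp: "C_k (Suc k) f \<Longrightarrow> C_k k f"
proof (induction k arbitrary: f)
  case 0
  then show ?case
    by (auto simp: differentiable_imp_continuous_within intro!: continuous_at_imp_continuous_on)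
next
  case (Suc k)
  then show ?case
    by (subst C_k.simps(2)) (auto simp del: C_k.simps(2) simp: C_k.simps(2)[of "Suc k"])
qed

lemma C_k_continuous: "C_k k f \<Longrightarrow> continuous_on UNIV f"
  by (induction k) (use C_k_Suc_imp in auto)

lemma smooth_continuous: "smooth f \<Longrightarrow> continuous_on UNIV f"
  using C_k_continuous smooth_def by blast

lemma C_k_const: "C_k k (\<lambda>x. c)"
proof (induction k arbitrary: c)
  case (Suc k)
  show ?case
    by (rule C_k_SucI[where f' = "\<lambda>x h. 0"]) (use Suc in auto)
qed auto

lemma C_k_component: "C_k k (\<lambda>x. x $ i)"
proof (cases k)
  case (Suc l)
  show ?thesis unfolding Suc
    by (rule C_k_SucI[where f' = "\<lambda>x h. h $ i"])
       (auto intro: C_k_const bounded_linear_imp_has_derivative bounded_linear_vec_nth)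
qed (auto intro!: continuous_intros)

lemma C_k_add: "C_k k f \<Longrightarrow> C_k k g \<Longrightarrow> C_k k (\<lambda>x. f x + g x)"
proof (induction k arbitrary: f g)
  case (Suc k)
  show ?case
    by (rule C_k_SucI[where f' = "\<lambda>x h. frechet_derivative f (at x) h + frechet_derivative g (at x) h"])
       (use Suc in \<open>auto intro!: has_derivative_add simp flip: frechet_derivative_works\<close>)
qed (auto intro!: continuous_intros)

lemma C_k_mult: "C_k k f \<Longrightarrow> C_k k g \<Longrightarrow> C_k k (\<lambda>x. f x * g x)"
proof (induction k arbitrary: f g)
  case (Suc k)
  show ?case
  proof (rule C_k_SucI[where f' = "\<lambda>x h. f x * frechet_derivative g (at x) h + frechet_derivative f (at x) h * g x"])
    show "((\<lambda>x. f x * g x) has_derivative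
      (\<lambda>h. f x * frechet_derivative g (at x) h + frechet_derivative f (at x) h * g x)) (at x)" for x
      by (rule has_derivative_mult) (use Suc in \<open>auto simp flip: frechet_derivative_works\<close>)
    show "C_k k (\<lambda>x. f x * frechet_derivative g (at x) (axis i 1) + frechet_derivative f (at x) (axis i 1) * g x)" for i
      by (intro C_k_add Suc.IH) (use Suc.prems C_k_Suc_imp in auto)
  qed
qed (auto intro!: continuous_intros)

section \<open>Flat functions and radial bumps\<close>

text \<open>The classical flat function exp(-1/t), extended by 0. The polynomial factor in 1/t makes
  the family closed under differentiation.\<close>

definition flat :: "real poly \<Rightarrow> real \<Rightarrow> real" where
  "flat p t = (if t > 0 then poly p (1 / t) * exp (- (1 / t)) else 0)"

lemma poly_times_exp_minus_tendsto_0: "((\<lambda>x::real. poly p x * exp (- x)) \<longlongrightarrow> 0) at_top"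
proof -
  have "((\<lambda>x::real. \<Sum>i\<le>degree p. coeff p i * (x ^ i / exp x)) \<longlongrightarrow> (\<Sum>i\<le>degree p. coeff p i * 0)) at_top"
    by (intro tendsto_intros tendsto_power_div_exp_0)
  then show ?thesis
    by (simp add: poly_altdef exp_minus sum_distrib_right divide_inverse mult.assoc)
qed

text \<open>With x = 1/t one has d/dt = - x^2 d/dx, which turns p(x) exp(-x) into x^2 (p - p')(x)
  exp(-x); \<open>[:0, 0, 1:]\<close> is x^2. At t = 0 the exponential beats every
  polynomial.\<close>

lemma flat_has_derivative:
  "(flat p has_real_derivative flat ([:0, 0, 1:] * (p - pderiv p)) t) (at t)"
proof -
  consider "t > 0" | "t < 0" | "t = 0" by linarith
  then show ?thesis
  proof cases
    case 1
    have "((\<lambda>t. poly p (1 / t) * exp (- (1 / t))) has_real_derivative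
        flat ([:0, 0, 1:] * (p - pderiv p)) t) (at t)"
      using 1 by (auto intro!: derivative_eq_intros DERIV_chain'[OF _ poly_DERIV]
          simp: flat_def power2_eq_square field_simps)
    then show ?thesis
      by (rule has_field_derivative_transform_within_open[where S="{0<..}"]) (use 1 in \<open>auto simp: flat_def\<close>)
  next
    case 2
    have "((\<lambda>t. 0) has_real_derivative 0) (at t)" by simp
    then have "(flat p has_real_derivative 0) (at t)"
      by (rule has_field_derivative_transform_within_open[where S="{..<0}"]) (use 2 in \<open>auto simp: flat_def\<close>)
    then show ?thesis using 2 by (simp add: flat_def)
  next
    case 3
    have "((\<lambda>h. flat p h / h) \<longlongrightarrow> 0) (at_left 0)"
    proof (rule tendsto_eventually)
      show "\<forall>\<^sub>F h in at_left 0. flat p h / h = 0"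
        by (auto simp: eventually_at_filter flat_def)
    qed
    moreover have "((\<lambda>h. flat p h / h) \<longlongrightarrow> 0) (at_right 0)"
    proof -
      \<comment> \<open>\<open>pCons 0 p\<close> is x times \<open>p\<close>: the difference
        quotient at 0 carries one more factor 1/h.\<close>
      have "((\<lambda>h. poly (pCons 0 p) (inverse h) * exp (- inverse h)) \<longlongrightarrow> 0) (at_right (0::real))"
        by (rule filterlim_compose[OF poly_times_exp_minus_tendsto_0 filterlim_inverse_at_top_right])
      then show ?thesis
        by (rule tendsto_cong[THEN iffD1, rotated])
           (auto simp: eventually_at_filter flat_def divide_simps)
    qed
    ultimately have "((\<lambda>h. flat p h / h) \<longlongrightarrow> 0) (at 0)"
      by (rule filterlim_split_at)
    then show ?thesis
      using 3 by (simp add: has_field_derivative_iff flat_def)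
  qed
qed

text \<open>Each partial derivative is a flat function of the same radial argument, with another
  polynomial, times a multiple of a coordinate. The induction on \<open>k\<close> therefore keeps
  \<open>p\<close> arbitrary.\<close>

lemma smooth_flat_radial: "smooth (\<lambda>x::real^'n::finite. flat p (r - x \<bullet> x))"
  unfolding smooth_def
proof
  show "C_k k (\<lambda>x::real^'n. flat p (r - x \<bullet> x))" for k
  proof (induction k arbitrary: p)
    case 0
    have "continuous_on UNIV (flat p)"
      by (rule DERIV_continuous_on[OF has_field_derivative_at_within[OF flat_has_derivative]])
    then have "continuous_on UNIV (\<lambda>x::real^'n. flat p (r - x \<bullet> x))"
      by (rule continuous_on_compose2) (auto intro!: continuous_on_diff continuous_on_inner continuous_on_const continuous_on_id)
    then show ?case by simp
  next
    case (Suc k)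
    let ?q = "[:0, 0, 1:] * (p - pderiv p)"
    show ?case
    proof (rule C_k_SucI[where f' = "\<lambda>x h. flat ?q (r - x \<bullet> x) * (- 2 * (x \<bullet> h))"])
      have "((\<lambda>x::real^'n. r - x \<bullet> x) has_derivative (\<lambda>h. - 2 * (x \<bullet> h))) (at x)" for x
        by (auto intro!: derivative_eq_intros simp: inner_commute)
      from has_derivative_compose[OF this flat_has_derivative[unfolded has_field_derivative_def]]
      show "((\<lambda>x::real^'n. flat p (r - x \<bullet> x)) has_derivative
          (\<lambda>h. flat ?q (r - x \<bullet> x) * (- 2 * (x \<bullet> h)))) (at x)" for x .
      show "C_k k (\<lambda>x::real^'n. flat ?q (r - x \<bullet> x) * (- 2 * (x \<bullet> axis i 1)))" for i
        by (simp only: inner_axis inner_real_def mult_1_right, intro C_k_mult Suc C_k_const C_k_component)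
    qed
  qed
qed

text \<open>Composing exp(-1/t) with r^2 - |x|^2 gives a function supported in a closed ball inside
  \<open>U\<close>. The bound by 1 lets an integral against \<phi> be compared with a
  volume.\<close>

lemma bump_function_le_1_exists:
  fixes U :: "(real ^ 'n::finite) set"
  assumes "open U" "0 \<in> U"
  obtains \<phi> where "\<phi> \<in> bump_functions U" "\<And>x. \<phi> x \<le> 1"
proof -
  obtain r where r: "r > 0" "cball 0 r \<subseteq> U"
    using assms open_contains_cball by blast
  define \<phi> where "\<phi> = (\<lambda>x::real^'n. flat 1 (r\<^sup>2 - x \<bullet> x))"
  have "{x. \<phi> x \<noteq> 0} \<subseteq> cball 0 r"
  proof
    fix x assume "x \<in> {x. \<phi> x \<noteq> 0}"
    then have "(norm x)\<^sup>2 \<le> r\<^sup>2"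
      by (auto simp: \<phi>_def flat_def dot_square_norm split: if_splits)
    then show "x \<in> cball 0 r"
      using r(1) by (simp add: power2_le_iff_abs_le)
  qed
  then have "closure {x. \<phi> x \<noteq> 0} \<subseteq> cball 0 r"
    by (rule closure_minimal) simp
  then have "closure {x. \<phi> x \<noteq> 0} \<subseteq> U" using r(2) by (rule order_trans)
  moreover have "smooth \<phi>" unfolding \<phi>_def by (rule smooth_flat_radial)
  moreover have "\<phi> x \<ge> 0" "\<phi> x \<le> 1" for x
    by (auto simp: \<phi>_def flat_def)
  moreover have "\<phi> 0 > 0" using r(1) by (auto simp: \<phi>_def flat_def)
  ultimately show ?thesis using that by (auto simp: bump_functions_def)
qed

lemma bump_functions_mono: "U \<subseteq> V \<Longrightarrow> bump_functions U \<subseteq> bump_functions V"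
  by (auto simp: bump_functions_def)

subsection \<open>Faces of the Newton polyhedron\<close>

text \<open>A monotone subsequence that is not increasing is decreasing, and a decreasing sequence
  of naturals is constant once it reaches its minimum.\<close>

lemma incseq_subseq_nat:
  fixes s :: "nat \<Rightarrow> nat"
  obtains \<phi> where "strict_mono \<phi>" "incseq (\<lambda>k. s (\<phi> k))"
proof -
  obtain f where f: "strict_mono f" "monoseq (\<lambda>n. s (f n))"
    using seq_monosub by blast
  show ?thesis
  proof (cases "incseq (\<lambda>n. s (f n))")
    case False
    then have dec: "decseq (\<lambda>n. s (f n))"
      using f(2) monoseq_iff by blast
    obtain N where N: "\<And>n. s (f N) \<le> s (f n)"
      using ex_has_least_nat[of "\<lambda>_. True" 0 "\<lambda>n. s (f n)"] by auto
    have "s (f (N + k)) = s (f N)" for k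
      using N[of "N + k"] decseqD[OF dec, of N "N + k"] by simp
    then have "incseq (\<lambda>k. s (f (N + k)))" by (simp add: incseq_def)
    moreover have "strict_mono (\<lambda>k. f (N + k))"
      using f(1) by (simp add: strict_mono_def)
    ultimately show ?thesis using that by blast
  qed (use f that in blast)
qed

text \<open>The coordinates are treated one after another; a further subsequence keeps those already
  treated increasing.\<close>

lemma incseq_subseq_multi:
  fixes f :: "nat \<Rightarrow> 'i \<Rightarrow> nat"
  assumes "finite I"
  shows "\<exists>\<phi>. strict_mono \<phi> \<and> (\<forall>i\<in>I. incseq (\<lambda>k. f (\<phi> k) i))"
  using assms
proof induction
  case empty
  show ?case by (intro exI[of _ id]) (auto simp: strict_mono_def)
next
  case (insert j I)
  then obtain \<phi> where \<phi>: "strict_mono \<phi>" "\<forall>i\<in>I. incseq (\<lambda>k. f (\<phi> k) i)" by blast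
  obtain \<psi> where \<psi>: "strict_mono \<psi>" "incseq (\<lambda>k. f (\<phi> (\<psi> k)) j)"
    using incseq_subseq_nat[of "\<lambda>k. f (\<phi> k) j"] by blast
  have "incseq (\<lambda>k. f (\<phi> (\<psi> k)) i)" if "i \<in> I" for i
    using \<phi>(2) that strict_mono_mono[OF \<psi>(1)] by (auto simp: incseq_def mono_def)
  with \<phi> \<psi> show ?case
    by (intro exI[of _ "\<lambda>k. \<phi> (\<psi> k)"]) (auto simp: strict_mono_def)
qed

text \<open>\<open>A\<close> consists of the minimal elements of \<open>X\<close>. If there were
  infinitely many, an injective sequence of them would have a coordinatewise increasing subsequence,
  hence two distinct comparable members.\<close>

lemma dickson:
  fixes X :: "('n::finite \<Rightarrow> nat) set"
  obtains A where "finite A" "A \<subseteq> X" "\<And>\<alpha>. \<alpha> \<in> X \<Longrightarrow> \<exists>\<beta>\<in>A. \<beta> \<le> \<alpha>"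
proof
  let ?A = "{\<beta>\<in>X. \<forall>\<gamma>\<in>X. \<gamma> \<le> \<beta> \<longrightarrow> \<gamma> = \<beta>}"
  show "?A \<subseteq> X" by blast
  show "\<exists>\<beta>\<in>?A. \<beta> \<le> \<alpha>" if \<alpha>: "\<alpha> \<in> X" for \<alpha>
  proof -
    \<comment> \<open>Below \<alpha>, an element of least coordinate sum is minimal, since anything
      strictly smaller has a smaller sum.\<close>
    obtain \<beta> where \<beta>: "\<beta> \<in> X" "\<beta> \<le> \<alpha>"
      and min: "\<And>\<gamma>. \<gamma> \<in> X \<Longrightarrow> \<gamma> \<le> \<alpha> \<Longrightarrow> sum \<beta> UNIV \<le> sum \<gamma> UNIV"
      using ex_has_least_nat[of "\<lambda>\<beta>. \<beta> \<in> X \<and> \<beta> \<le> \<alpha>" \<alpha> "\<lambda>\<beta>. sum \<beta> UNIV"] \<alpha>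
      by blast
    have "\<gamma> = \<beta>" if \<gamma>: "\<gamma> \<in> X" "\<gamma> \<le> \<beta>" for \<gamma>
    proof (rule ccontr)
      assume "\<gamma> \<noteq> \<beta>"
      then obtain i where "\<gamma> i < \<beta> i"
        using \<gamma>(2) by (metis antisym ext le_fun_def linorder_not_less)
      then have "sum \<gamma> UNIV < sum \<beta> UNIV"
        using \<gamma>(2) by (intro sum_strict_mono_ex1) (auto simp: le_fun_def)
      with min[of \<gamma>] \<gamma> \<beta>(2) show False by (meson linorder_not_less order_trans)
    qed
    with \<beta> show ?thesis by blast
  qed
  show "finite ?A"
  proof (rule ccontr)
    assume "infinite ?A"
    then obtain f :: "nat \<Rightarrow> 'n \<Rightarrow> nat" where f: "inj f" "range f \<subseteq> ?A"
      using infinite_countable_subset by blast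
    obtain \<phi> where \<phi>: "strict_mono \<phi>" "\<forall>i\<in>UNIV. incseq (\<lambda>k. f (\<phi> k) i)"
      using incseq_subseq_multi[of UNIV f] by auto
    have "f (\<phi> 0) \<le> f (\<phi> 1)"
      using \<phi>(2) by (auto simp: le_fun_def incseq_def)
    then have "f (\<phi> 0) = f (\<phi> 1)" using f(2) by blast
    then have "\<phi> 0 = \<phi> 1" using f(1) by (simp add: inj_def)
    with strict_monoD[OF \<phi>(1), of 0 1] show False by simp
  qed
qed

section \<open>Faces of convex hulls and polyhedrality of the Newton polyhedron\<close>

text \<open>A point of \<open>F\<close> lies in the relative interior of the hull of those points of
  \<open>S\<close> that carry positive weight in a convex combination for it; a face meeting this
  relative interior contains the whole hull.\<close>

lemma face_of_convex_hull_eq: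
  fixes S :: "'a::euclidean_space set"
  assumes "F face_of convex hull S"
  shows "F = convex hull (F \<inter> S)"
proof
  show "convex hull (F \<inter> S) \<subseteq> F"
    using assms by (simp add: face_of_imp_convex subset_hull)
  show "F \<subseteq> convex hull (F \<inter> S)"
  proof
    fix x assume x: "x \<in> F"
    then have "x \<in> convex hull S" using assms face_of_imp_subset by blast
    then obtain T u where T: "finite T" "T \<subseteq> S" and u: "\<forall>t\<in>T. 0 \<le> u t" "sum u T = 1"
        "(\<Sum>t\<in>T. u t *\<^sub>R t) = x"
      unfolding convex_hull_explicit by blast
    define T' where "T' = {t\<in>T. u t > 0}"
    have T': "finite T'" "T' \<subseteq> S" using T by (auto simp: T'_def)
    have "sum u T' = 1" "(\<Sum>t\<in>T'. u t *\<^sub>R t) = x"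
      unfolding u(2)[symmetric] u(3)[symmetric] using T(1) u(1)
      by (force simp: T'_def intro!: sum.mono_neutral_left)+
    then have "x \<in> rel_interior (convex hull T')"
      using explicit_subset_rel_interior_convex_hull_minimal[OF T'(1)] by (fastforce simp: T'_def)
    moreover have "convex hull T' \<subseteq> convex hull S" using T'(2) by (rule hull_mono)
    ultimately have sub: "convex hull T' \<subseteq> F"
      using subset_of_face_of[OF assms] x by blast
    then have "T' \<subseteq> F \<inter> S" using T'(2) hull_subset[of T' convex] by (meson le_inf_iff order_trans)
    moreover have "x \<in> convex hull T'"
      using \<open>x \<in> rel_interior (convex hull T')\<close> rel_interior_subset by blast
    ultimately show "x \<in> convex hull (F \<inter> S)" using hull_mono by blast
  qed
qed

text \<open>A face is the hull of its traces on the \<open>Q i\<close>, each trace is a face of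
  \<open>Q i\<close>, and a polyhedron has finitely many faces; so only finitely many families of
  traces occur.\<close>

lemma finite_faces_convex_hull_UN_polyhedra:
  fixes Q :: "'i \<Rightarrow> 'a::euclidean_space set"
  assumes I: "finite I" and poly: "\<And>i. i \<in> I \<Longrightarrow> polyhedron (Q i)"
  shows "finite {F. F face_of convex hull (\<Union>i\<in>I. Q i)}"
proof (rule finite_subset)
  let ?G = "Pi\<^sub>E I (\<lambda>i. {G. G face_of Q i})"
  show "finite ((\<lambda>g. convex hull (\<Union>i\<in>I. g i)) ` ?G)"
    using I poly by (intro finite_imageI finite_PiE) (auto intro: finite_polyhedron_faces)
  show "{F. F face_of convex hull (\<Union>i\<in>I. Q i)} \<subseteq> (\<lambda>g. convex hull (\<Union>i\<in>I. g i)) ` ?G"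
  proof
    fix F assume "F \<in> {F. F face_of convex hull (\<Union>i\<in>I. Q i)}"
    then have F: "F face_of convex hull (\<Union>i\<in>I. Q i)" by simp
    define g where "g = restrict (\<lambda>i. F \<inter> Q i) I"
    have "(F \<inter> Q i) face_of Q i" if "i \<in> I" for i
    proof -
      have "convex hull (\<Union>i\<in>I. Q i) \<inter> Q i = Q i"
        using that hull_subset[of "\<Union>i\<in>I. Q i" convex] by blast
      then show ?thesis
        using face_of_slice[OF F, of "Q i"] poly[OF that] polyhedron_imp_convex by metis
    qed
    then have "g \<in> ?G" by (auto simp: g_def)
    moreover have "(\<Union>i\<in>I. g i) = F \<inter> (\<Union>i\<in>I. Q i)" by (auto simp: g_def)
    then have "F = convex hull (\<Union>i\<in>I. g i)"
      using face_of_convex_hull_eq[OF F] by simp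
    ultimately show "F \<in> (\<lambda>g. convex hull (\<Union>i\<in>I. g i)) ` ?G" by blast
  qed
qed

lemma polyhedron_octant: "polyhedron {x :: real ^ 'n::finite. \<forall>i. x $ i \<ge> c i}"
proof -
  have "{x :: real ^ 'n. \<forall>i. x $ i \<ge> c i} = \<Inter> (range (\<lambda>i. {x. axis i 1 \<bullet> x \<ge> c i}))"
    by (auto simp: inner_axis')
  then show ?thesis
    by (auto simp: polyhedron_halfspace_ge)
qed

text \<open>Polyhedrality makes every face exposed. By Dickson's lemma finitely many octants
  suffice; the hull is then a polytope plus the positive orthant, hence closed, and a closed convex
  set with finitely many faces is a polyhedron.\<close>

lemma polyhedron_newton_polyhedron: "polyhedron (newton_polyhedron s)"
proof -
  define Q where "Q = (\<lambda>\<alpha>::'a \<Rightarrow> nat. {x :: real ^ 'a. \<forall>i. x $ i \<ge> real (\<alpha> i)})"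
  define P where "P = {x :: real ^ 'a. \<forall>i. 0 \<le> x $ i}"
  obtain A where A: "finite A" "A \<subseteq> {\<alpha>. s \<alpha> \<noteq> 0}"
      "\<And>\<alpha>. \<alpha> \<in> {\<alpha>. s \<alpha> \<noteq> 0} \<Longrightarrow> \<exists>\<beta>\<in>A. \<beta> \<le> \<alpha>"
    using dickson by metis
  have "Q \<alpha> \<subseteq> Q \<beta>" if "\<beta> \<le> \<alpha>" for \<alpha> \<beta>
    using that by (auto simp: Q_def le_fun_def) (meson of_nat_mono order_trans)
  then have "(\<Union>\<alpha>\<in>{\<alpha>. s \<alpha> \<noteq> 0}. Q \<alpha>) \<subseteq> (\<Union>\<alpha>\<in>A. Q \<alpha>)"
    using A(3) by (intro UN_least) (meson UN_upper order_trans)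
  moreover have "(\<Union>\<alpha>\<in>A. Q \<alpha>) \<subseteq> (\<Union>\<alpha>\<in>{\<alpha>. s \<alpha> \<noteq> 0}. Q \<alpha>)"
    using A(2) by (rule UN_mono) simp
  ultimately have "(\<Union>\<alpha>\<in>{\<alpha>. s \<alpha> \<noteq> 0}. Q \<alpha>) = (\<Union>\<alpha>\<in>A. Q \<alpha>)"
    by (rule antisym)
  then have N: "newton_polyhedron s = convex hull (\<Union>\<alpha>\<in>A. Q \<alpha>)"
    by (simp add: newton_polyhedron_def Q_def)
  have "Q \<alpha> = {multi_vec \<alpha>} + P" for \<alpha>
  proof
    show "Q \<alpha> \<subseteq> {multi_vec \<alpha>} + P"
    proof
      fix x assume "x \<in> Q \<alpha>"
      then have "x - multi_vec \<alpha> \<in> P" by (auto simp: Q_def P_def multi_vec_def)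
      then show "x \<in> {multi_vec \<alpha>} + P"
        by (metis add.commute diff_add_cancel insertI1 set_plus_intro)
    qed
  qed (auto simp: Q_def P_def multi_vec_def set_plus_def)
  then have "(\<Union>\<alpha>\<in>A. Q \<alpha>) = multi_vec ` A + P"
    by (auto simp: set_plus_def)
  moreover have "convex P"
    using polyhedron_octant[of "\<lambda>_. 0"] unfolding P_def by (rule polyhedron_imp_convex)
  ultimately have "newton_polyhedron s = convex hull (multi_vec ` A) + P"
    unfolding N by (simp add: convex_hull_set_plus hull_same)
  also have "\<dots> = (\<Union>x\<in>convex hull (multi_vec ` A). \<Union>y\<in>P. {x + y})"
    by (auto simp: set_plus_def)
  finally have "closed (newton_polyhedron s)"
    using compact_closed_sums[of "convex hull (multi_vec ` A)" P] A(1)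
    by (simp add: compact_convex_hull finite_imp_compact P_def closed_positive_orthant)
  moreover have "finite {F. F face_of newton_polyhedron s}"
    unfolding N using A(1)
    by (rule finite_faces_convex_hull_UN_polyhedra) (auto simp: Q_def polyhedron_octant)
  ultimately show ?thesis
    by (simp add: polyhedron_eq_finite_faces newton_polyhedron_def)
qed

text \<open>Translation by the nonnegative vector \<open>y - x\<close> maps the union of octants
  into itself, hence also its hull.\<close>

lemma newton_polyhedron_upward:
  assumes "x \<in> newton_polyhedron s" "\<And>i. x $ i \<le> y $ i"
  shows "y \<in> newton_polyhedron s"
proof -
  let ?X = "\<Union>\<alpha>\<in>{\<alpha>. s \<alpha> \<noteq> 0}. {x. \<forall>i. x $ i \<ge> real (\<alpha> i)}"
  have "(\<lambda>z. (y - x) + z) ` ?X \<subseteq> ?X"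
  proof clarify
    fix \<alpha> z assume "s \<alpha> \<noteq> 0" "\<forall>i. real (\<alpha> i) \<le> z $ i"
    then show "(y - x) + z \<in> ?X"
      using assms(2) by (intro UN_I[of \<alpha>]) (auto intro!: add_increasing)
  qed
  then have "convex hull ((\<lambda>z. (y - x) + z) ` ?X) \<subseteq> convex hull ?X" by (rule hull_mono)
  then have "(\<lambda>z. (y - x) + z) ` (convex hull ?X) \<subseteq> convex hull ?X"
    by (simp only: convex_hull_translation)
  then have "(y - x) + x \<in> newton_polyhedron s"
    using assms(1) unfolding newton_polyhedron_def by blast
  then show ?thesis by simp
qed

lemma multi_vec_in_newton_polyhedron: "s \<alpha> \<noteq> 0 \<Longrightarrow> multi_vec \<alpha> \<in> newton_polyhedron s"
  unfolding newton_polyhedron_def by (rule hull_inc) (auto simp: multi_vec_def)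

section \<open>A positive weight exposing a bounded face\<close>

lemma finite_uniform_lower_bound:
  fixes f :: "'a \<Rightarrow> real"
  assumes "finite A" "\<And>a. a \<in> A \<Longrightarrow> 0 < f a"
  obtains c where "c > 0" "\<And>a. a \<in> A \<Longrightarrow> c \<le> f a"
  using assms
proof (induction A arbitrary: thesis)
  case empty
  show ?case by (rule empty(1)[of 1]) auto
next
  case (insert x A)
  obtain c where "c > 0" "\<And>a. a \<in> A \<Longrightarrow> c \<le> f a"
    by (rule insert.IH) (use insert.prems in auto)
  then show ?case
    by (intro insert.prems(1)[of "min c (f x)"]) (use insert.prems in \<open>auto intro: min.coboundedI1\<close>)
qed

lemma finite_multi_index_le: "finite {\<alpha> :: 'n::finite \<Rightarrow> nat. sum \<alpha> UNIV \<le> K}"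
proof (rule finite_subset)
  show "{\<alpha> :: 'n \<Rightarrow> nat. sum \<alpha> UNIV \<le> K} \<subseteq> Pi\<^sub>E UNIV (\<lambda>_. {..K})"
  proof
    fix \<alpha> :: "'n \<Rightarrow> nat" assume \<alpha>: "\<alpha> \<in> {\<alpha>. sum \<alpha> UNIV \<le> K}"
    have "\<alpha> i \<le> sum \<alpha> UNIV" for i by (rule member_le_sum) auto
    with \<alpha> show "\<alpha> \<in> Pi\<^sub>E UNIV (\<lambda>_. {..K})" using order_trans by fastforce
  qed
qed (auto intro: finite_PiE)

lemma finite_multi_indices_in_bounded:
  assumes "bounded F"
  shows "finite {\<alpha>. multi_vec \<alpha> \<in> F}"
proof -
  obtain B where B: "\<And>x. x \<in> F \<Longrightarrow> norm x \<le> B" using assms bounded_iff by blast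
  have "{\<alpha>. multi_vec \<alpha> \<in> F} \<subseteq> Pi\<^sub>E UNIV (\<lambda>_. {..nat \<lceil>B\<rceil>})"
  proof
    fix \<alpha> assume "\<alpha> \<in> {\<alpha>. multi_vec \<alpha> \<in> F}"
    then have "norm (multi_vec \<alpha>) \<le> B" using B by simp
    then have "real (\<alpha> i) \<le> B" for i
      using component_le_norm_cart[of "multi_vec \<alpha>" i] by (simp add: multi_vec_def)
    then have "\<alpha> i \<le> nat \<lceil>B\<rceil>" for i
      by (meson of_nat_le_iff order_trans real_nat_ceiling_ge)
    then show "\<alpha> \<in> Pi\<^sub>E UNIV (\<lambda>_. {..nat \<lceil>B\<rceil>})" by auto
  qed
  then show ?thesis by (rule finite_subset) (auto intro: finite_PiE)
qed

lemma inner_multi_vec: "w \<bullet> multi_vec \<alpha> = (\<Sum>i\<in>UNIV. w $ i * real (\<alpha> i))"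
  by (simp add: inner_vec_def multi_vec_def)

text \<open>Since \<open>F\<close> is bounded, it is exposed by a functional whose coordinates are all positive: a
  vanishing coordinate would allow \<open>F\<close> to be translated along an axis.\<close>

lemma bounded_face_weight:
  fixes s :: "('n::finite \<Rightarrow> nat) \<Rightarrow> real"
  assumes F: "F face_of newton_polyhedron s" "F \<noteq> {}" "bounded F"
  obtains w b \<eta> where "\<And>i. 0 < w $ i" "\<And>z. z \<in> F \<Longrightarrow> w \<bullet> z = b" "0 < \<eta>"
    "\<And>\<alpha>. s \<alpha> \<noteq> 0 \<Longrightarrow> multi_vec \<alpha> \<notin> F \<Longrightarrow> b + \<eta> * (1 + real (sum \<alpha> UNIV)) \<le> w \<bullet> multi_vec \<alpha>"
proof -
  have "F exposed_face_of newton_polyhedron s"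
    using F(1) exposed_face_of_polyhedron polyhedron_newton_polyhedron by blast
  then obtain a c where ac: "newton_polyhedron s \<subseteq> {x. a \<bullet> x \<le> c}"
      "F = newton_polyhedron s \<inter> {x. a \<bullet> x = c}"
    unfolding exposed_face_of_def by blast
  \<comment> \<open>An exposed face is where a linear functional is maximal, whereas a weight is
    minimal on \<open>F\<close>; hence the signs.\<close>
  define w where "w = - a"
  define b where "b = - c"
  have N: "b \<le> w \<bullet> x" if "x \<in> newton_polyhedron s" for x
    using ac(1) that by (auto simp: w_def b_def)
  have Feq: "x \<in> F \<longleftrightarrow> x \<in> newton_polyhedron s \<and> w \<bullet> x = b" for x
    using ac(2) by (auto simp: w_def b_def)
  obtain z where z: "z \<in> F" using F(2) by blast
  have up: "z + axis i t \<in> newton_polyhedron s" if "t \<ge> 0" for i t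
    by (rule newton_polyhedron_upward[of z]) (use z Feq that in \<open>auto simp: axis_def\<close>)
  have pos: "0 < w $ i" for i
  proof (rule ccontr)
    assume neg: "\<not> 0 < w $ i"
    have "0 \<le> w $ i"
      using N[OF up[of 1 i]] z Feq by (simp add: inner_add_right inner_axis)
    then have "w $ i = 0" using neg by simp
    then have inF: "z + axis i t \<in> F" if "t \<ge> 0" for t
      using up[OF that] z Feq by (simp add: inner_add_right inner_axis)
    obtain B where B: "\<And>x. x \<in> F \<Longrightarrow> norm x \<le> B" using F(3) bounded_iff by blast
    have "B \<ge> 0" using B[OF z] norm_ge_zero order_trans by blast
    \<comment> \<open>This point of the ray is too far out: subtracting \<open>z\<close> changes the
      norm by at most \<open>norm z\<close>.\<close>
    have "norm (z + axis i (B + norm z + 1)) \<le> B"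
      by (rule B, rule inF) (use \<open>B \<ge> 0\<close> in auto)
    moreover have "norm (axis i (B + norm z + 1)) \<le> norm (z + axis i (B + norm z + 1)) + norm z"
      using norm_triangle_ineq4[of "z + axis i (B + norm z + 1)" z] by simp
    moreover have "norm (axis i (B + norm z + 1)) = B + norm z + 1"
      using \<open>B \<ge> 0\<close> by (simp add: norm_eq_sqrt_inner inner_axis_axis)
    ultimately show False by simp
  qed
  obtain \<mu> where \<mu>: "\<mu> > 0" "\<And>i. \<mu> \<le> w $ i"
    using finite_uniform_lower_bound[of UNIV "\<lambda>i. w $ i"] pos by auto
  have w_ge: "\<mu> * real (sum \<alpha> UNIV) \<le> w \<bullet> multi_vec \<alpha>" for \<alpha>
    unfolding inner_multi_vec of_nat_sum sum_distrib_left
    by (intro sum_mono mult_right_mono \<mu>(2)) auto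
  \<comment> \<open>Beyond this degree \<open>2 * b + \<mu> \<le> \<mu> * l\<close> holds, and the
    linear growth of the weight gives the gap with rate \<open>\<mu> / 2\<close>; the finitely many
    other multi-indices are collected in \<open>X\<close>.\<close>
  define K where "K = nat \<lceil>2 * b / \<mu> + 1\<rceil>"
  define X where "X = {\<alpha>. s \<alpha> \<noteq> 0 \<and> multi_vec \<alpha> \<notin> F \<and> sum \<alpha> UNIV \<le> K}"
  have "finite X"
    by (rule finite_subset[OF _ finite_multi_index_le[of K]]) (auto simp: X_def)
  \<comment> \<open>The gap is measured relative to \<open>1 + sum \<alpha> UNIV\<close>: it must
    grow with the degree to absorb perturbations of the weight.\<close>
  moreover have "0 < (w \<bullet> multi_vec \<alpha> - b) / (1 + real (sum \<alpha> UNIV))" if "\<alpha> \<in> X" for \<alpha>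
  proof -
    have "multi_vec \<alpha> \<in> newton_polyhedron s" "multi_vec \<alpha> \<notin> F"
      using that multi_vec_in_newton_polyhedron by (auto simp: X_def)
    then have "b < w \<bullet> multi_vec \<alpha>" using N Feq by fastforce
    then show ?thesis by (intro divide_pos_pos) (auto intro!: add_pos_nonneg simp del: of_nat_sum)
  qed
  ultimately obtain \<eta> where \<eta>: "\<eta> > 0"
      "\<And>\<alpha>. \<alpha> \<in> X \<Longrightarrow> \<eta> \<le> (w \<bullet> multi_vec \<alpha> - b) / (1 + real (sum \<alpha> UNIV))"
    using finite_uniform_lower_bound[of X "\<lambda>\<alpha>. (w \<bullet> multi_vec \<alpha> - b) / (1 + real (sum \<alpha> UNIV))"]
    by blast
  show ?thesis
  proof (rule that)
    show "0 < w $ i" for i by (rule pos)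
    show "w \<bullet> z = b" if "z \<in> F" for z using that Feq by blast
    show "0 < min \<eta> (\<mu> / 2)" using \<eta>(1) \<mu>(1) by simp
    fix \<alpha> assume \<alpha>: "s \<alpha> \<noteq> 0" "multi_vec \<alpha> \<notin> F"
    define l where "l = real (sum \<alpha> UNIV)"
    have l: "l \<ge> 0" by (simp add: l_def sum_nonneg)
    show "b + min \<eta> (\<mu> / 2) * (1 + real (sum \<alpha> UNIV)) \<le> w \<bullet> multi_vec \<alpha>"
    proof (cases "sum \<alpha> UNIV \<le> K")
      case True
      then have "\<alpha> \<in> X" using \<alpha> by (simp add: X_def)
      then have "\<eta> \<le> (w \<bullet> multi_vec \<alpha> - b) / (1 + l)" unfolding l_def by (rule \<eta>(2))
      then have "\<eta> * (1 + l) \<le> w \<bullet> multi_vec \<alpha> - b"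
        using l by (simp add: pos_le_divide_eq add_pos_nonneg)
      moreover have "min \<eta> (\<mu> / 2) * (1 + l) \<le> \<eta> * (1 + l)"
        by (rule mult_right_mono) (use l in auto)
      ultimately show ?thesis unfolding l_def by linarith
    next
      case False
      then have "2 * b / \<mu> + 1 \<le> l"
        unfolding K_def l_def by linarith
      then have "2 * b + \<mu> \<le> \<mu> * l"
        using \<mu>(1) by (simp add: field_simps)
      moreover have "min \<eta> (\<mu> / 2) * (1 + l) \<le> \<mu> / 2 * (1 + l)"
        by (rule mult_right_mono) (use l in auto)
      ultimately show ?thesis
        using w_ge[of \<alpha>] by (simp add: l_def field_simps)
    qed
  qed
qed

subsection \<open>Sublevel volumes from the growth index\<close>

text \<open>The logarithm tends to minus infinity, so powers below \<open>m\<close> vanish after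
  division; those above have zero coefficients.\<close>

lemma log_sum_dominant:
  fixes c :: "nat \<Rightarrow> real"
  assumes m: "m < N" and zero: "\<And>i. i < N \<Longrightarrow> m < i \<Longrightarrow> c i = 0"
  shows "((\<lambda>\<epsilon>. (\<Sum>i<N. c i * ln \<epsilon> ^ i) / ln \<epsilon> ^ m) \<longlongrightarrow> c m) (at_right 0)"
proof -
  have "((\<lambda>\<epsilon>. c i * ln \<epsilon> ^ i / ln \<epsilon> ^ m) \<longlongrightarrow> (if i = m then c m else 0)) (at_right 0)"
    if i: "i < N" for i
  proof -
    have ln0: "\<forall>\<^sub>F \<epsilon> in at_right 0. ln \<epsilon> \<noteq> (0::real)"
      using eventually_at_right_less[of 0] eventually_at_right_real[OF zero_less_one]
      by eventually_elim auto
    consider "i < m" | "i = m" | "m < i" by linarith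
    then show ?thesis
    proof cases
      case 1
      have "((\<lambda>\<epsilon>. c i * inverse (ln \<epsilon>) ^ (m - i)) \<longlongrightarrow> c i * 0 ^ (m - i)) (at_right (0::real))"
        by (intro tendsto_intros tendsto_inverse_0_at_top filterlim_compose[OF tendsto_inverse_0]
            filterlim_mono[OF ln_at_0 at_bot_le_at_infinity order_refl])
      moreover have "\<forall>\<^sub>F \<epsilon> in at_right 0. c i * inverse (ln \<epsilon>) ^ (m - i) = c i * ln \<epsilon> ^ i / ln \<epsilon> ^ m"
        using ln0
      proof eventually_elim
        case (elim \<epsilon>)
        have "ln \<epsilon> ^ m = ln \<epsilon> ^ i * ln \<epsilon> ^ (m - i)"
          using 1 by (simp flip: power_add)
        then show ?case using elim by (simp add: field_simps power_inverse)
      qed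
      ultimately show ?thesis
        using 1 by (simp add: tendsto_cong power_0_left)
    next
      case 2
      have "\<forall>\<^sub>F \<epsilon> in at_right 0. c i * ln \<epsilon> ^ i / ln \<epsilon> ^ m = c m"
        using ln0 by eventually_elim (use 2 in simp)
      then show ?thesis using 2 tendsto_eventually by simp
    next
      case 3
      then show ?thesis using zero[OF i] by simp
    qed
  qed
  then have "((\<lambda>\<epsilon>. \<Sum>i<N. c i * ln \<epsilon> ^ i / ln \<epsilon> ^ m) \<longlongrightarrow> (\<Sum>i<N. if i = m then c m else 0)) (at_right 0)"
    by (intro tendsto_sum) auto
  then show ?thesis using m by (simp add: sum_divide_distrib)
qed

lemma open_sublevel_in_ball:
  fixes f :: "'a::metric_space \<Rightarrow> real"
  assumes "continuous_on UNIV f"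
  shows "open {y \<in> ball p \<rho>. \<bar>f y\<bar> < \<delta>}"
proof -
  have "{y \<in> ball p \<rho>. \<bar>f y\<bar> < \<delta>} = ball p \<rho> \<inter> {y. \<bar>f y\<bar> < \<delta>}" by auto
  then show ?thesis
    using assms by (auto intro!: open_Int open_Collect_less open_ball continuous_intros)
qed

lemma pos_sublevel_integral_le_measure:
  fixes f :: "real ^ 'n::finite \<Rightarrow> real"
  assumes f: "continuous_on UNIV f" and \<phi>: "\<And>x. 0 \<le> \<phi> x" "\<And>x. \<phi> x \<le> 1"
    and supp: "{x. \<phi> x \<noteq> 0} \<subseteq> ball 0 \<rho>"
  shows "pos_sublevel_integral f \<phi> \<delta> \<le> measure lborel {y \<in> ball 0 \<rho>. \<bar>f y\<bar> < \<delta>}"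
proof -
  let ?A = "{y \<in> ball 0 \<rho>. \<bar>f y\<bar> < \<delta>}"
  have A: "?A \<in> sets lborel" unfolding sets_lborel by (intro borel_open open_sublevel_in_ball f)
  have "emeasure lborel ?A \<le> emeasure lborel (ball (0::real^'n) \<rho>)"
    by (intro emeasure_mono) auto
  then have fin: "emeasure lborel ?A < \<infinity>"
    using emeasure_lborel_ball_finite[of "0::real^'n" \<rho>] by (simp add: order_le_less_trans)
  have eq: "integral\<^sup>L lborel (indicator ?A) = measure lborel ?A"
    using A by simp
  show ?thesis
  proof (cases "integrable lborel (\<lambda>x. indicator {x. 0 < f x \<and> f x < \<delta>} x *\<^sub>R \<phi> x)")
    case True
    have "pos_sublevel_integral f \<phi> \<delta> \<le> integral\<^sup>L lborel (indicator ?A)"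
      unfolding pos_sublevel_integral_def set_lebesgue_integral_def
    proof (rule integral_mono[OF True])
      show "integrable lborel (indicator ?A :: _ \<Rightarrow> real)"
        using A fin by (simp add: integrable_indicator_iff)
      fix x
      have "\<phi> x = 0 \<or> x \<in> ball 0 \<rho>" using supp by blast
      then show "indicator {x. 0 < f x \<and> f x < \<delta>} x *\<^sub>R \<phi> x \<le> indicator ?A x"
        using \<phi> by (auto simp: indicator_def)
    qed
    then show ?thesis unfolding eq .
  next
    \<comment> \<open>A non-integrable integrand has integral 0 by convention, so the bound is
      trivial.\<close>
    case False
    then show ?thesis
      by (simp add: pos_sublevel_integral_def set_lebesgue_integral_def not_integrable_integral_eq)
  qed
qed

text \<open>For a bump function bounded by 1 and supported in the ball, the sublevel integral is at
  most the volume, while its leading term bounds it from below. Giving up half of the leading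
  coefficient absorbs the remainder.\<close>

lemma growth_index_sublevel_measure:
  fixes f :: "real ^ 'n::finite \<Rightarrow> real"
  assumes f: "continuous_on UNIV f" and gi: "has_growth_index f (ereal a) m" and \<rho>: "\<rho> > 0"
  obtains C where "C > 0"
    "\<forall>\<^sub>F \<delta> in at_right 0. C * \<bar>ln \<delta>\<bar> ^ m * \<delta> powr a \<le> measure lborel {y \<in> ball 0 \<rho>. \<bar>f y\<bar> < \<delta>}"
proof -
  let ?N = "CARD('n)"
  obtain r U where U: "open U" "0 \<in> U"
    and exp: "\<And>\<phi>. \<phi> \<in> bump_functions U \<Longrightarrow> \<exists>c.
       has_log_power_expansion ?N (pos_sublevel_integral f \<phi>) r c \<and> leading_term ?N r c (ereal a) m"
    using gi unfolding has_growth_index_def by blast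
  obtain \<phi> where \<phi>: "\<phi> \<in> bump_functions (U \<inter> ball 0 \<rho>)" "\<And>x. \<phi> x \<le> 1"
    using bump_function_le_1_exists[of "U \<inter> ball 0 \<rho>"] U \<rho> by auto
  obtain c where c: "has_log_power_expansion ?N (pos_sublevel_integral f \<phi>) r c"
      "leading_term ?N r c (ereal a) m"
    using exp bump_functions_mono[of "U \<inter> ball 0 \<rho>" U] \<phi>(1) by blast
  define g where "g = pos_sublevel_integral f \<phi>"
  obtain j where j: "a = r j" "\<And>j' i. j' < j \<Longrightarrow> i < ?N \<Longrightarrow> c i j' = 0"
      "m < ?N" "c m j \<noteq> 0" "\<And>i. i < ?N \<Longrightarrow> m < i \<Longrightarrow> c i j = 0"
    using c(2) unfolding leading_term_def by auto
  \<comment> \<open>The expansion is cut exactly at the leading index \<open>j\<close>: the earlier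
    coefficients vanish, and the remainder is negligible against the leading term even for
    \<open>m = 0\<close>.\<close>
  have "(\<lambda>\<epsilon>. g \<epsilon> - (\<Sum>j\<le>j. \<Sum>i<?N. c i j * ln \<epsilon> ^ i * \<epsilon> powr r j)) \<in> o[at_right 0](\<lambda>\<epsilon>. \<epsilon> powr a)"
    using c(1) unfolding has_log_power_expansion_def g_def j(1) by blast
  also have "(\<lambda>\<epsilon>. g \<epsilon> - (\<Sum>j\<le>j. \<Sum>i<?N. c i j * ln \<epsilon> ^ i * \<epsilon> powr r j)) =
      (\<lambda>\<epsilon>. g \<epsilon> - (\<Sum>i<?N. c i j * ln \<epsilon> ^ i) * \<epsilon> powr a)"
    using j(2) by (simp add: lessThan_Suc_atMost[symmetric] j(1) sum_distrib_right)
  finally have "((\<lambda>\<epsilon>. (g \<epsilon> - (\<Sum>i<?N. c i j * ln \<epsilon> ^ i) * \<epsilon> powr a) / \<epsilon> powr a) \<longlongrightarrow> 0) (at_right 0)"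
    by (rule smalloD_tendsto)
  moreover have "\<forall>\<^sub>F \<epsilon> in at_right 0. norm (1 / ln \<epsilon> ^ m :: real) \<le> 1"
  proof -
    have "\<forall>\<^sub>F \<epsilon> in at_right 0. ln \<epsilon> \<le> (-1::real)"
      using ln_at_0 by (auto simp: filterlim_at_bot)
    then show ?thesis
    proof eventually_elim
      case (elim \<epsilon>)
      then have "1 \<le> \<bar>ln \<epsilon>\<bar> ^ m" by (intro one_le_power) auto
      then have "1 \<le> \<bar>ln \<epsilon> ^ m\<bar>" by (simp only: power_abs)
      then show ?case by (subst norm_divide, subst divide_le_eq_1_pos) (use elim in auto)
    qed
  qed
  then have "Bfun (\<lambda>\<epsilon>. 1 / ln \<epsilon> ^ m :: real) (at_right 0)" by (rule BfunI)
  ultimately have "((\<lambda>\<epsilon>. (g \<epsilon> - (\<Sum>i<?N. c i j * ln \<epsilon> ^ i) * \<epsilon> powr a) / \<epsilon> powr a * (1 / ln \<epsilon> ^ m)) \<longlongrightarrow> 0) (at_right 0)"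
    unfolding tendsto_Zfun_iff diff_0_right by (rule bounded_bilinear.Zfun_prod_Bfun[OF bounded_bilinear_mult])
  from tendsto_add[OF this log_sum_dominant[of m ?N "\<lambda>i. c i j"]]
  have "((\<lambda>\<epsilon>. (g \<epsilon> - (\<Sum>i<?N. c i j * ln \<epsilon> ^ i) * \<epsilon> powr a) / \<epsilon> powr a * (1 / ln \<epsilon> ^ m)
      + (\<Sum>i<?N. c i j * ln \<epsilon> ^ i) / ln \<epsilon> ^ m) \<longlongrightarrow> c m j) (at_right 0)"
    using j(3,5) by simp
  \<comment> \<open>Since ln \<epsilon> is negative, \<open>c m j\<close> may be negative for odd
    \<open>m\<close>; absolute values remove the sign.\<close>
  from tendsto_rabs[OF this] have lim: "((\<lambda>\<epsilon>. \<bar>(g \<epsilon> - (\<Sum>i<?N. c i j * ln \<epsilon> ^ i) * \<epsilon> powr a) / \<epsilon> powr a * (1 / ln \<epsilon> ^ m)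
      + (\<Sum>i<?N. c i j * ln \<epsilon> ^ i) / ln \<epsilon> ^ m\<bar>) \<longlongrightarrow> \<bar>c m j\<bar>) (at_right 0)" .
  show ?thesis
  proof
    show "\<bar>c m j\<bar> / 2 > 0" using j(4) by simp
    have "\<bar>c m j\<bar> / 2 < \<bar>c m j\<bar>" using j(4) by simp
    from order_tendstoD(1)[OF lim this] eventually_at_right_less[of 0] eventually_at_right_real[OF zero_less_one]
    show "\<forall>\<^sub>F \<delta> in at_right 0. \<bar>c m j\<bar> / 2 * \<bar>ln \<delta>\<bar> ^ m * \<delta> powr a \<le> measure lborel {y \<in> ball 0 \<rho>. \<bar>f y\<bar> < \<delta>}"
    proof eventually_elim
      case (elim \<delta>)
      then have \<delta>: "ln \<delta> < 0" "0 < \<delta>" "0 < \<delta> powr a" by auto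
      have "(g \<delta> - (\<Sum>i<?N. c i j * ln \<delta> ^ i) * \<delta> powr a) / \<delta> powr a * (1 / ln \<delta> ^ m)
          + (\<Sum>i<?N. c i j * ln \<delta> ^ i) / ln \<delta> ^ m = g \<delta> / (\<delta> powr a * ln \<delta> ^ m)"
        using \<delta> by (simp add: divide_simps)
      then have "\<bar>c m j\<bar> / 2 < \<bar>g \<delta>\<bar> / (\<delta> powr a * \<bar>ln \<delta>\<bar> ^ m)"
        using elim(1) \<delta> by (simp add: abs_mult power_abs)
      moreover have "0 < \<delta> powr a * \<bar>ln \<delta>\<bar> ^ m" using \<delta> by simp
      ultimately have "\<bar>c m j\<bar> / 2 * (\<delta> powr a * \<bar>ln \<delta>\<bar> ^ m) < \<bar>g \<delta>\<bar>"
        by (simp only: pos_less_divide_eq)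
      moreover have "0 \<le> g \<delta>"
        using \<phi>(1) unfolding g_def pos_sublevel_integral_def set_lebesgue_integral_def
        by (intro integral_nonneg_AE) (auto simp: bump_functions_def)
      moreover have "g \<delta> \<le> measure lborel {y \<in> ball 0 \<rho>. \<bar>f y\<bar> < \<delta>}"
        unfolding g_def
      proof (rule pos_sublevel_integral_le_measure[OF f])
        show "{x. \<phi> x \<noteq> 0} \<subseteq> ball 0 \<rho>"
          using \<phi>(1) closure_subset[of "{x. \<phi> x \<noteq> 0}"] by (auto simp: bump_functions_def)
      qed (use \<phi> in \<open>auto simp: bump_functions_def\<close>)
      ultimately show ?case by (simp add: mult_ac)
    qed
  qed
qed

text \<open>A finite index forces \<open>f p = 0\<close>, and one of the two signs of
  \<open>f\<close> attains both index and multiplicity, also in a tie. Both signs have the same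
  sublevel sets in absolute value, and volume is translation invariant.\<close>

lemma abs_growth_index_at_sublevel_measure:
  fixes f :: "real ^ 'n::finite \<Rightarrow> real"
  assumes f: "continuous_on UNIV f" and gi: "abs_has_growth_index_at f p (ereal a) m" and \<rho>: "\<rho> > 0"
  obtains C where "C > 0"
    "\<forall>\<^sub>F \<delta> in at_right 0. C * \<bar>ln \<delta>\<bar> ^ m * \<delta> powr a \<le> measure lborel {y \<in> ball p \<rho>. \<bar>f y\<bar> < \<delta>}"
proof -
  define h where "h = (\<lambda>x. f (x + p))"
  have h: "continuous_on UNIV h" "continuous_on UNIV (\<lambda>x. - h x)"
    unfolding h_def by (intro continuous_intros continuous_on_compose2[OF f]; simp)+
  have "abs_has_growth_index h (ereal a) m"
    using gi by (auto simp: abs_has_growth_index_at_def h_def split: if_splits)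
  then have "has_growth_index h (ereal a) m \<or> has_growth_index (\<lambda>x. - h x) (ereal a) m"
    unfolding abs_has_growth_index_def by (auto simp: min_def max_def split: if_splits)
  then obtain C where C: "C > 0"
    "\<forall>\<^sub>F \<delta> in at_right 0. C * \<bar>ln \<delta>\<bar> ^ m * \<delta> powr a \<le> measure lborel {y \<in> ball 0 \<rho>. \<bar>h y\<bar> < \<delta>}"
  proof
    assume "has_growth_index h (ereal a) m"
    from growth_index_sublevel_measure[OF h(1) this \<rho>] that show thesis by blast
  next
    assume "has_growth_index (\<lambda>x. - h x) (ereal a) m"
    from growth_index_sublevel_measure[OF h(2) this \<rho>] that show thesis by auto
  qed
  have "measure lborel {y \<in> ball 0 \<rho>. \<bar>h y\<bar> < \<delta>} = measure lborel {y \<in> ball p \<rho>. \<bar>f y\<bar> < \<delta>}" for \<delta>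
  proof -
    let ?A = "{y \<in> ball 0 \<rho>. \<bar>h y\<bar> < \<delta>}" and ?B = "{y \<in> ball p \<rho>. \<bar>f y\<bar> < \<delta>}"
    have eq: "(+) p ` ?A = ?B"
    proof
      show "?B \<subseteq> (+) p ` ?A"
      proof
        fix y assume "y \<in> ?B"
        then have "y - p \<in> ?A" by (auto simp: h_def dist_norm norm_minus_commute)
        then show "y \<in> (+) p ` ?A" by (intro image_eqI[of _ _ "y - p"]) auto
      qed
    qed (auto simp: h_def dist_norm add.commute)
    have "measure lebesgue ((+) p ` ?A) = measure lebesgue ?A"
      by (rule measure_translation)
    moreover have "measure lebesgue X = measure lborel X" if "open X" for X :: "(real ^ 'n) set"
      using that by (simp add: measure_completion)
    ultimately show ?thesis
      using open_sublevel_in_ball[OF f, of p \<rho> \<delta>] open_sublevel_in_ball[OF h(1), of 0 \<rho> \<delta>]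
      unfolding eq by (simp only:)
  qed
  with C that show ?thesis by simp
qed

subsection \<open>Anisotropic scaling\<close>

text \<open>The entries of \<open>w\<close> are minus the logarithms of the scaling factors. A
  monomial then scales by the exponential of a linear form in its exponent, and inverting the map
  means negating \<open>w\<close>.\<close>

definition exp_stretch :: "real ^ 'n::finite \<Rightarrow> real ^ 'n \<Rightarrow> real ^ 'n" where
  "exp_stretch w y = (\<chi> i. exp (- w $ i) * y $ i)"

lemma exp_stretch_component [simp]: "exp_stretch w y $ i = exp (- w $ i) * y $ i"
  by (simp add: exp_stretch_def)

lemma monomial_at_exp_stretch:
  "monomial_at (exp_stretch w y) \<alpha> = exp (- (w \<bullet> multi_vec \<alpha>)) * monomial_at y \<alpha>"
proof -
  have "exp (- (w \<bullet> multi_vec \<alpha>)) = (\<Prod>i\<in>UNIV. exp (- w $ i) ^ \<alpha> i)"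
    by (simp add: inner_multi_vec exp_sum mult.commute flip: sum_negf exp_of_nat_mult)
  then show ?thesis
    by (simp add: monomial_at_def power_mult_distrib prod.distrib)
qed

lemma abs_monomial_at_le:
  assumes "\<And>i. \<bar>x $ i\<bar> \<le> R"
  shows "\<bar>monomial_at x \<alpha>\<bar> \<le> R ^ sum \<alpha> UNIV"
  unfolding monomial_at_def abs_prod power_sum power_abs
  using assms by (intro prod_mono) (auto intro: power_mono)

lemma continuous_on_monomial_at: "continuous_on A (\<lambda>x. monomial_at x \<alpha>)"
  unfolding monomial_at_def by (intro continuous_intros)

lemma continuous_on_face_poly: "continuous_on A (face_poly s F)"
  unfolding face_poly_def by (intro continuous_intros continuous_on_monomial_at)

section \<open>The Taylor series on a box around the origin\<close>

text \<open>At the corner \<open>vec R\<close> every monomial attains its maximum over the box.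
  Summability over an index set is absolute for reals, so this one point yields a majorant for the
  whole box.\<close>

lemma has_taylor_expansion_box:
  fixes s :: "('n::finite \<Rightarrow> nat) \<Rightarrow> real"
  assumes "has_taylor_expansion f s 0"
  obtains R where "R > 0" "(\<lambda>\<alpha>. \<bar>s \<alpha>\<bar> * R ^ sum \<alpha> UNIV) summable_on UNIV"
    "\<And>x. (\<And>i. \<bar>x $ i\<bar> \<le> R) \<Longrightarrow> ((\<lambda>\<alpha>. s \<alpha> * monomial_at x \<alpha>) has_sum f x) UNIV"
proof -
  obtain e where e: "e > 0"
      "\<And>x. norm x < e \<Longrightarrow> ((\<lambda>\<alpha>. s \<alpha> * monomial_at x \<alpha>) has_sum f x) UNIV"
    using assms by (auto simp: has_taylor_expansion_def eventually_nhds_metric)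
  \<comment> \<open>Dividing by twice the dimension puts the box inside the ball of radius
    \<open>e\<close>, by the l1 bound on the norm.\<close>
  define R where "R = e / (2 * real CARD('n))"
  have R: "R > 0" using e(1) by (simp add: R_def)
  have hs: "((\<lambda>\<alpha>. s \<alpha> * monomial_at x \<alpha>) has_sum f x) UNIV" if "\<And>i. \<bar>x $ i\<bar> \<le> R" for x
  proof (rule e(2))
    have "norm x \<le> (\<Sum>i\<in>UNIV. \<bar>x $ i\<bar>)" by (rule norm_le_l1_cart)
    also have "\<dots> \<le> (\<Sum>i\<in>(UNIV::'n set). R)" by (intro sum_mono that)
    also have "\<dots> < e" using e(1) by (simp add: R_def)
    finally show "norm x < e" .
  qed
  have "monomial_at (vec R) \<alpha> = R ^ sum \<alpha> UNIV" for \<alpha> :: "'n \<Rightarrow> nat"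
    by (simp add: monomial_at_def power_sum)
  then have "((\<lambda>\<alpha>. s \<alpha> * R ^ sum \<alpha> UNIV) has_sum f (vec R)) UNIV"
    using hs[of "vec R"] R by simp
  then have "(\<lambda>\<alpha>. s \<alpha> * R ^ sum \<alpha> UNIV) summable_on UNIV"
    by (rule has_sum_imp_summable)
  then have "(\<lambda>\<alpha>. norm (s \<alpha> * R ^ sum \<alpha> UNIV)) summable_on UNIV"
    by (rule summable_on_iff_abs_summable_on_real[THEN iffD1])
  then have "(\<lambda>\<alpha>. \<bar>s \<alpha>\<bar> * R ^ sum \<alpha> UNIV) summable_on UNIV"
    using R by (simp add: abs_mult power_abs)
  with R hs that show ?thesis by blast
qed

lemma continuous_on_power_series_box:
  fixes s :: "('n::finite \<Rightarrow> nat) \<Rightarrow> real"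
  assumes sm: "(\<lambda>\<alpha>. \<bar>s \<alpha>\<bar> * R ^ sum \<alpha> UNIV) summable_on UNIV"
    and hs: "\<And>x. (\<And>i. \<bar>x $ i\<bar> \<le> R) \<Longrightarrow> ((\<lambda>\<alpha>. s \<alpha> * monomial_at x \<alpha>) has_sum f x) UNIV"
  shows "continuous_on {x. \<forall>i. \<bar>x $ i\<bar> \<le> R} f"
proof -
  let ?Y = "{x :: real ^ 'n. \<forall>i. \<bar>x $ i\<bar> \<le> R}"
  have "uniform_limit ?Y (\<lambda>X x. \<Sum>\<alpha>\<in>X. s \<alpha> * monomial_at x \<alpha>)
      (\<lambda>x. \<Sum>\<^sub>\<infinity>\<alpha>. s \<alpha> * monomial_at x \<alpha>) (finite_subsets_at_top UNIV)"
  proof (rule Weierstrass_m_test_general[OF _ sm])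
    show "norm (s \<alpha> * monomial_at x \<alpha>) \<le> \<bar>s \<alpha>\<bar> * R ^ sum \<alpha> UNIV" if "x \<in> ?Y" for \<alpha> x
      using abs_monomial_at_le[of x R \<alpha>] that by (auto simp: abs_mult intro: mult_left_mono)
  qed
  then have "continuous_on ?Y (\<lambda>x. \<Sum>\<^sub>\<infinity>\<alpha>. s \<alpha> * monomial_at x \<alpha>)"
    by (rule uniform_limit_theorem[rotated])
       (auto intro!: always_eventually continuous_intros continuous_on_monomial_at)
  then show ?thesis
    by (rule continuous_on_cong[THEN iffD1, rotated -1]) (auto intro: infsumI hs)
qed

text \<open>Monomials on \<open>F\<close> scale exactly by exp(-c). Off \<open>F\<close> the gap
  gives a further factor exp(-t) exp(-t |\<alpha>|): the first is the gain, and the second amounts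
  to shrinking \<open>y\<close> into the box, where the majorant applies.\<close>

lemma power_series_exp_stretch_approx:
  fixes s :: "('n::finite \<Rightarrow> nat) \<Rightarrow> real"
  assumes R: "0 \<le> R" and sm: "(\<lambda>\<alpha>. \<bar>s \<alpha>\<bar> * R ^ sum \<alpha> UNIV) summable_on UNIV"
    and hs: "((\<lambda>\<alpha>. s \<alpha> * monomial_at (exp_stretch w y) \<alpha>) has_sum f) UNIV"
    and fin: "finite {\<alpha>. multi_vec \<alpha> \<in> F}"
    and wF: "\<And>z. z \<in> F \<Longrightarrow> w \<bullet> z = c"
    and gap: "\<And>\<alpha>. s \<alpha> \<noteq> 0 \<Longrightarrow> multi_vec \<alpha> \<notin> F \<Longrightarrow> c + t * (1 + real (sum \<alpha> UNIV)) \<le> w \<bullet> multi_vec \<alpha>"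
    and y: "\<And>i. exp (- t) * \<bar>y $ i\<bar> \<le> R"
  shows "\<bar>f - exp (- c) * face_poly s F y\<bar> \<le> exp (- c) * (exp (- t) * (\<Sum>\<^sub>\<infinity>\<alpha>. \<bar>s \<alpha>\<bar> * R ^ sum \<alpha> UNIV))"
proof -
  let ?Z = "exp_stretch w y" and ?G = "{\<alpha>. multi_vec \<alpha> \<in> F}"
  have "exp (- c) * face_poly s F y = (\<Sum>\<alpha>\<in>?G. s \<alpha> * monomial_at ?Z \<alpha>)"
    unfolding face_poly_def sum_distrib_left
    by (intro sum.cong) (auto simp: monomial_at_exp_stretch wF)
  moreover have "((\<lambda>\<alpha>. s \<alpha> * monomial_at ?Z \<alpha>) has_sum (\<Sum>\<alpha>\<in>?G. s \<alpha> * monomial_at ?Z \<alpha>)) ?G"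
    using fin by (rule has_sum_finite)
  ultimately have hsG: "((\<lambda>\<alpha>. s \<alpha> * monomial_at ?Z \<alpha>) has_sum (f - exp (- c) * face_poly s F y)) (UNIV - ?G)"
    using hs by (auto intro: has_sum_Diff)
  have bound: "((\<lambda>\<alpha>. exp (- c) * (exp (- t) * (\<bar>s \<alpha>\<bar> * R ^ sum \<alpha> UNIV))) has_sum
      exp (- c) * (exp (- t) * (\<Sum>\<^sub>\<infinity>\<alpha>. \<bar>s \<alpha>\<bar> * R ^ sum \<alpha> UNIV))) UNIV"
    by (intro has_sum_cmult_right has_sum_infsum sm)
  have le: "norm (s \<alpha> * monomial_at ?Z \<alpha>) \<le> exp (- c) * (exp (- t) * (\<bar>s \<alpha>\<bar> * R ^ sum \<alpha> UNIV))"
    if "\<alpha> \<notin> ?G" for \<alpha>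
  proof (cases "s \<alpha> = 0")
    case False
    let ?l = "sum \<alpha> UNIV"
    have "\<bar>monomial_at (exp (- t) *\<^sub>R y) \<alpha>\<bar> \<le> R ^ ?l"
      by (rule abs_monomial_at_le) (use y in \<open>auto simp: abs_mult\<close>)
    moreover have "monomial_at (exp (- t) *\<^sub>R y) \<alpha> = exp (- (t * real ?l)) * monomial_at y \<alpha>"
      using exp_of_nat_mult[of ?l "- t", symmetric]
      by (simp add: monomial_at_def power_mult_distrib prod.distrib power_sum mult.commute del: of_nat_sum)
    ultimately have "exp (- (t * real ?l)) * \<bar>monomial_at y \<alpha>\<bar> \<le> R ^ ?l"
      by (simp add: abs_mult)
    moreover have "exp (- (w \<bullet> multi_vec \<alpha>)) \<le> exp (- c) * exp (- t) * exp (- (t * real ?l))"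
      using gap[OF False] that by (simp add: algebra_simps flip: exp_add)
    then have "exp (- (w \<bullet> multi_vec \<alpha>)) * \<bar>monomial_at y \<alpha>\<bar>
        \<le> exp (- c) * exp (- t) * exp (- (t * real ?l)) * \<bar>monomial_at y \<alpha>\<bar>"
      by (rule mult_right_mono) simp
    ultimately have "exp (- (w \<bullet> multi_vec \<alpha>)) * \<bar>monomial_at y \<alpha>\<bar> \<le> exp (- c) * exp (- t) * R ^ ?l"
      by (smt (verit) mult.assoc mult_left_mono exp_ge_zero mult_nonneg_nonneg)
    then have "\<bar>s \<alpha>\<bar> * (exp (- (w \<bullet> multi_vec \<alpha>)) * \<bar>monomial_at y \<alpha>\<bar>) \<le> \<bar>s \<alpha>\<bar> * (exp (- c) * exp (- t) * R ^ ?l)"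
      by (rule mult_left_mono) simp
    then show ?thesis by (simp add: monomial_at_exp_stretch abs_mult mult_ac)
  qed simp
  have "(\<lambda>\<alpha>. norm (s \<alpha> * monomial_at ?Z \<alpha>)) summable_on (UNIV - ?G)"
    by (rule summable_on_iff_abs_summable_on_real[THEN iffD1, OF has_sum_imp_summable[OF hsG]])
  from norm_infsum_bound[OF this] have "norm (f - exp (- c) * face_poly s F y)
      \<le> (\<Sum>\<^sub>\<infinity>\<alpha>\<in>UNIV - ?G. norm (s \<alpha> * monomial_at ?Z \<alpha>))"
    unfolding infsumI[OF hsG] .
  also have "\<dots> \<le> (\<Sum>\<^sub>\<infinity>\<alpha>. exp (- c) * (exp (- t) * (\<bar>s \<alpha>\<bar> * R ^ sum \<alpha> UNIV)))"
    using \<open>(\<lambda>\<alpha>. norm (s \<alpha> * monomial_at ?Z \<alpha>)) summable_on (UNIV - ?G)\<close> has_sum_imp_summable[OF bound] le R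
    by (intro infsum_mono_neutral) auto
  also have "\<dots> = exp (- c) * (exp (- t) * (\<Sum>\<^sub>\<infinity>\<alpha>. \<bar>s \<alpha>\<bar> * R ^ sum \<alpha> UNIV))"
    using bound by (rule infsumI)
  finally show ?thesis by simp
qed

section \<open>Separated weights in a subspace\<close>

text \<open>The points form a lattice cube with step 2n in an orthonormal basis of \<open>E\<close>,
  n being the dimension of the whole space. Distinct points are at distance at least 2n, so by the
  l1 bound on the norm some coordinate differs by at least 2.\<close>

lemma separated_points_in_subspace:
  fixes E :: "(real ^ 'n::finite) set"
  assumes E: "subspace E" and r: "0 \<le> r"
  obtains W where "finite W" "W \<subseteq> E" "\<And>w. w \<in> W \<Longrightarrow> norm w \<le> r"
    "\<And>w w'. w \<in> W \<Longrightarrow> w' \<in> W \<Longrightarrow> w \<noteq> w' \<Longrightarrow> \<exists>i. 2 \<le> \<bar>w $ i - w' $ i\<bar>"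
    "(r / (2 * real CARD('n) ^ 2)) ^ dim E \<le> real (card W)"
proof -
  obtain B where B: "B \<subseteq> E" "pairwise orthogonal B" "\<And>x. x \<in> B \<Longrightarrow> norm x = 1"
      "independent B" "card B = dim E"
    using orthonormal_basis_subspace[OF E] by metis
  have finB: "finite B" using B(4) independent_imp_finite by blast
  define n where "n = real CARD('n)"
  have n: "n > 0" by (simp add: n_def)
  have cardB: "real (card B) \<le> n"
    using dim_subset_UNIV[of E] B(5) by (simp add: n_def)
  \<comment> \<open>There are at most n basis vectors, each with coefficient at most
    \<open>2 * n * K\<close>, so this \<open>K\<close> keeps the norm at most
    \<open>r\<close>.\<close>
  define K where "K = nat \<lfloor>r / (2 * n\<^sup>2)\<rfloor>"
  have K: "real K \<le> r / (2 * n\<^sup>2)" "r / (2 * n\<^sup>2) \<le> real K + 1"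
    using r by (auto simp: K_def)
  define P where "P = Pi\<^sub>E B (\<lambda>_. {..K})"
  define g where "g = (\<lambda>m. \<Sum>b\<in>B. (2 * n * real (m b)) *\<^sub>R b)"
  have finP: "finite P" using finB by (auto simp: P_def intro: finite_PiE)
  have coord: "g m \<bullet> b = 2 * n * real (m b)" if "b \<in> B" for m b
  proof -
    have "g m \<bullet> b = (\<Sum>b'\<in>B. if b' = b then 2 * n * real (m b) else 0)"
      unfolding g_def inner_sum_left
    proof (rule sum.cong[OF refl])
      fix b' assume "b' \<in> B"
      then show "(2 * n * real (m b')) *\<^sub>R b' \<bullet> b = (if b' = b then 2 * n * real (m b) else 0)"
        using B(2) B(3)[OF that] that by (auto simp: pairwise_def orthogonal_def dot_square_norm)
    qed
    then show ?thesis using finB that by simp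
  qed
  have sep: "\<exists>i. 2 \<le> \<bar>g m $ i - g m' $ i\<bar>" if m: "m \<in> P" "m' \<in> P" "m \<noteq> m'" for m m'
  proof -
    obtain b where b: "b \<in> B" "m b \<noteq> m' b"
      using m by (metis P_def PiE_ext)
    have "2 * n * 1 \<le> 2 * n * \<bar>real (m b) - real (m' b)\<bar>"
      using b(2) n by (intro mult_left_mono) linarith+
    also have "\<dots> = \<bar>(g m - g m') \<bullet> b\<bar>"
      using n by (simp add: inner_diff_left coord b(1) abs_mult flip: right_diff_distrib)
    also have "\<dots> \<le> norm (g m - g m')"
      using Cauchy_Schwarz_ineq2[of "g m - g m'" b] B(3)[OF b(1)] by simp
    also have "\<dots> \<le> (\<Sum>i\<in>UNIV. \<bar>(g m - g m') $ i\<bar>)" by (rule norm_le_l1_cart)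
    finally have *: "2 * n \<le> (\<Sum>i\<in>UNIV. \<bar>(g m - g m') $ i\<bar>)" by simp
    show ?thesis
    proof (rule ccontr)
      assume "\<not> ?thesis"
      then have "(\<Sum>i\<in>UNIV. \<bar>(g m - g m') $ i\<bar>) < (\<Sum>i\<in>(UNIV :: 'n set). 2)"
        by (intro sum_strict_mono) (auto simp: not_le)
      with * show False by (simp add: n_def)
    qed
  qed
  have inj: "inj_on g P"
    by (rule inj_onI) (use sep in force)
  show ?thesis
  proof (rule that)
    show "finite (g ` P)" using finP by simp
    show "g ` P \<subseteq> E"
      using B(1) E by (auto simp: g_def intro!: subspace_sum subspace_mul)
    show "norm w \<le> r" if w: "w \<in> g ` P" for w
    proof -
      obtain m where m: "m \<in> P" "w = g m" using w by blast
      have "norm w \<le> (\<Sum>b\<in>B. norm ((2 * n * real (m b)) *\<^sub>R b))"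
        unfolding m(2) g_def by (rule norm_sum)
      also have "\<dots> \<le> (\<Sum>b\<in>B. 2 * n * real K)"
        using m(1) n B(3) by (intro sum_mono) (auto simp: P_def PiE_def Pi_def)
      also have "\<dots> = real (card B) * (2 * n * real K)" by simp
      also have "\<dots> \<le> n * (2 * n * (r / (2 * n\<^sup>2)))"
        using cardB K(1) n by (intro mult_mono) auto
      also have "\<dots> = r" using n by (simp add: power2_eq_square)
      finally show ?thesis .
    qed
    show "\<exists>i. 2 \<le> \<bar>w $ i - w' $ i\<bar>" if "w \<in> g ` P" "w' \<in> g ` P" "w \<noteq> w'" for w w'
      using that sep by blast
    \<comment> \<open>Each coefficient takes the \<open>K + 1\<close> values from 0 to
      \<open>K\<close>, which makes up for the rounding in \<open>K\<close>.\<close>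
    have "(r / (2 * n\<^sup>2)) ^ dim E \<le> (real K + 1) ^ dim E"
      using K r by (intro power_mono) auto
    also have "\<dots> = real (card (g ` P))"
      using inj finB by (simp add: card_image P_def card_PiE B(5) add.commute)
    finally show "(r / (2 * real CARD('n) ^ 2)) ^ dim E \<le> real (card (g ` P))"
      by (simp add: n_def)
  qed
qed

section \<open>Volumes of stretched sets and the sublevel integral\<close>

lemma exp_stretch_inverse: "exp_stretch (- w) (exp_stretch w y) = y"
  by (simp add: vec_eq_iff flip: mult.assoc exp_add)

lemma continuous_on_exp_stretch: "continuous_on A (exp_stretch w)"
  unfolding exp_stretch_def by (intro continuous_intros)

text \<open>Openness comes from the inverse stretch, the volume from the determinant of a diagonal
  map. The volume formula concerns Lebesgue measure, which agrees with \<open>lborel\<close> on open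
  sets.\<close>

lemma exp_stretch_image_open:
  fixes E :: "(real ^ 'n::finite) set"
  assumes "open E" "bounded E"
  shows "open (exp_stretch w ` E)" "emeasure lborel (exp_stretch w ` E) < \<infinity>"
    "measure lborel (exp_stretch w ` E) = exp (- (\<Sum>i\<in>UNIV. w $ i)) * measure lborel E"
proof -
  have "exp_stretch w ` E = exp_stretch (- w) -` E"
  proof (intro set_eqI iffI)
    fix x assume "x \<in> exp_stretch (- w) -` E"
    moreover have "x = exp_stretch w (exp_stretch (- w) x)"
      using exp_stretch_inverse[of "- w" x] by simp
    ultimately show "x \<in> exp_stretch w ` E" by blast
  qed (auto simp: exp_stretch_inverse)
  then show op: "open (exp_stretch w ` E)"
    using open_vimage[OF assms(1) continuous_on_exp_stretch] by simp
  have E: "E \<in> lmeasurable" using assms lmeasurable_open by blast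
  have eq: "exp_stretch w = (\<lambda>y. \<chi> i. exp (- w $ i) * y $ i)"
    by (auto simp: exp_stretch_def)
  have "exp_stretch w ` E \<in> lmeasurable"
    unfolding eq by (rule measurable_stretch[OF E])
  then show "emeasure lborel (exp_stretch w ` E) < \<infinity>"
    using op by (auto simp: fmeasurable_def emeasure_completion)
  have "(\<Prod>i\<in>UNIV. exp (- w $ i)) = exp (- (\<Sum>i\<in>UNIV. w $ i))"
    by (simp add: exp_sum flip: sum_negf)
  then have "measure lebesgue (exp_stretch w ` E) = exp (- (\<Sum>i\<in>UNIV. w $ i)) * measure lebesgue E"
    unfolding eq measure_stretch[OF E] by simp
  then show "measure lborel (exp_stretch w ` E) = exp (- (\<Sum>i\<in>UNIV. w $ i)) * measure lborel E"
    using op assms(1) by (simp add: measure_completion)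
qed

text \<open>The stretched sets are disjoint parts of the sublevel set on which \<phi> is at least
  \<kappa>, so their volumes add up inside the integral.\<close>

lemma abs_sublevel_integral_ge:
  fixes S :: "real ^ 'n::finite \<Rightarrow> real"
  assumes U: "open U" "bounded U" "continuous_on U S" and \<phi>: "\<phi> \<in> bump_functions U"
    and W: "finite W" and E: "\<And>w. w \<in> W \<Longrightarrow> open (E w)" "\<And>w. w \<in> W \<Longrightarrow> bounded (E w)"
    and disj: "\<And>w w'. w \<in> W \<Longrightarrow> w' \<in> W \<Longrightarrow> w \<noteq> w' \<Longrightarrow> exp_stretch w ` E w \<inter> exp_stretch w' ` E w' = {}"
    and sub: "\<And>w y. w \<in> W \<Longrightarrow> y \<in> E w \<Longrightarrow> \<bar>S (exp_stretch w y)\<bar> < \<epsilon>"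
      "\<And>w y. w \<in> W \<Longrightarrow> y \<in> E w \<Longrightarrow> \<kappa> \<le> \<phi> (exp_stretch w y)"
    and \<kappa>: "0 < \<kappa>"
  shows "\<kappa> * (\<Sum>w\<in>W. exp (- (\<Sum>i\<in>UNIV. w $ i)) * measure lborel (E w)) \<le> abs_sublevel_integral S \<phi> \<epsilon>"
proof -
  define G where "G = (\<Union>w\<in>W. exp_stretch w ` E w)"
  \<comment> \<open>\<open>S\<close> is controlled only on \<open>U\<close>. Cutting the sublevel
    set down to \<open>U\<close> makes it open and leaves the integral unchanged, since \<phi>
    vanishes outside \<open>U\<close>.\<close>
  define V where "V = {x \<in> U. \<bar>S x\<bar> < \<epsilon>}"
  have \<phi>0: "\<phi> x \<ge> 0" for x using \<phi> by (simp add: bump_functions_def)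
  have \<phi>U: "x \<in> U" if "\<phi> x \<noteq> 0" for x
    using \<phi> that closure_subset[of "{x. \<phi> x \<noteq> 0}"] by (auto simp: bump_functions_def)
  have "V = U \<inter> (\<lambda>x. \<bar>S x\<bar>) -` {..<\<epsilon>}" by (auto simp: V_def)
  moreover have "continuous_on U (\<lambda>x. \<bar>S x\<bar>)" by (intro continuous_intros U)
  ultimately have "open V"
    using U(1) continuous_open_preimage by (metis open_lessThan)
  have G: "open G" unfolding G_def using exp_stretch_image_open(1) E by blast
  have "measure lborel G = (\<Sum>w\<in>W. measure lborel (exp_stretch w ` E w))"
    unfolding G_def
  proof (rule measure_finite_Union[OF W])
    show "(\<lambda>w. exp_stretch w ` E w) ` W \<subseteq> sets lborel"
      using exp_stretch_image_open(1) E borel_open unfolding sets_lborel by blast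
    show "disjoint_family_on (\<lambda>w. exp_stretch w ` E w) W"
      using disj by (auto simp: disjoint_family_on_def)
    show "emeasure lborel (exp_stretch w ` E w) \<noteq> \<infinity>" if "w \<in> W" for w
      using exp_stretch_image_open(2)[OF E[OF that], of w] by simp
  qed
  also have "\<dots> = (\<Sum>w\<in>W. exp (- (\<Sum>i\<in>UNIV. w $ i)) * measure lborel (E w))"
    using E by (intro sum.cong refl exp_stretch_image_open(3))
  finally have mG: "measure lborel G = \<dots>" .
  have GV: "x \<in> V" "\<kappa> \<le> \<phi> x" if x: "x \<in> G" for x
  proof -
    obtain w y where wy: "w \<in> W" "y \<in> E w" "x = exp_stretch w y" using x by (auto simp: G_def)
    then show "\<kappa> \<le> \<phi> x" using sub(2) by simp
    then have "x \<in> U" using \<kappa> by (intro \<phi>U) simp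
    then show "x \<in> V" using sub(1) wy by (simp add: V_def)
  qed
  have cont: "continuous_on UNIV \<phi>" using \<phi> smooth_continuous by (auto simp: bump_functions_def)
  let ?K = "closure {x. \<phi> x \<noteq> 0}"
  have "?K \<subseteq> U" using \<phi> by (simp add: bump_functions_def)
  then have "compact ?K" using U(2) bounded_subset compact_eq_bounded_closed by blast
  then have "integrable lborel (\<lambda>x. indicator ?K x *\<^sub>R \<phi> x)"
    by (rule borel_integrable_compact) (rule continuous_on_subset[OF cont subset_UNIV])
  also have "(\<lambda>x. indicator ?K x *\<^sub>R \<phi> x) = \<phi>"
    using closure_subset[of "{x. \<phi> x \<noteq> 0}"] by (force simp: indicator_def fun_eq_iff)
  finally have "integrable lborel (\<lambda>x. indicator V x *\<^sub>R \<phi> x)"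
    using \<open>open V\<close> by (intro integrable_mult_indicator) auto
  moreover have "emeasure lborel G < \<infinity>"
  proof -
    have "G \<subseteq> U" using GV(1) by (auto simp: V_def)
    then have "bounded G" using U(2) bounded_subset by blast
    then have "G \<in> lmeasurable" using G lmeasurable_open by blast
    then show ?thesis using G by (auto simp: fmeasurable_def emeasure_completion)
  qed
  then have "integrable lborel (\<lambda>x. \<kappa> * indicator G x)"
    using G by (intro integrable_mult_right) (auto simp: integrable_indicator_iff)
  moreover have "\<kappa> * indicator G x \<le> indicator V x *\<^sub>R \<phi> x" for x
    using GV \<phi>0 by (auto simp: indicator_def)
  ultimately have "(LINT x|lborel. \<kappa> * indicator G x) \<le> (LINT x|lborel. indicator V x *\<^sub>R \<phi> x)"
    by (intro integral_mono)
  also have "(\<lambda>x. indicator V x *\<^sub>R \<phi> x) = (\<lambda>x. indicator {x. \<bar>S x\<bar> < \<epsilon>} x *\<^sub>R \<phi> x)"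
    using \<phi>U by (auto simp: V_def indicator_def fun_eq_iff)
  also have "(LINT x|lborel. \<kappa> * indicator G x) = \<kappa> * measure lborel G"
    using G by simp
  finally show ?thesis
    by (simp add: mG abs_sublevel_integral_def set_lebesgue_integral_def)
qed

subsection \<open>The lower bound\<close>

lemma eventually_exp_decay:
  fixes c e K :: real
  assumes "c > 0" "e > 0"
  shows "\<forall>\<^sub>F T in at_top. K * exp (- (c * T)) < e"
proof -
  have "((\<lambda>T. K * exp (- (c * T))) \<longlongrightarrow> K * 0) at_top"
    using assms(1)
    by (intro tendsto_mult_left filterlim_compose[OF exp_at_bot]
        filterlim_compose[OF filterlim_uminus_at_bot_at_top] filterlim_tendsto_pos_mult_at_top[OF tendsto_const])
       (auto intro: filterlim_ident)
  then show ?thesis using assms(2) by (auto dest: order_tendstoD(2))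
qed

text \<open>In the ball the i-th coordinate stays strictly between 1/2 and 3/2 of its absolute value
  at \<open>x\<close>, so two such values have ratio below 3; the two stretches differ there by a
  factor of at least exp 2, which is more than 3.\<close>

lemma exp_stretch_images_disjoint:
  fixes x :: "real ^ 'n::finite"
  assumes \<rho>: "\<And>i. 2 * \<rho> \<le> \<bar>x $ i\<bar>" and sep: "2 \<le> \<bar>w $ i - w' $ i\<bar>"
  shows "exp_stretch w ` ball x \<rho> \<inter> exp_stretch w' ` ball x \<rho> = {}"
proof -
  have close: "\<bar>x $ i\<bar> / 2 < \<bar>y $ i\<bar>" "\<bar>y $ i\<bar> < 3 * (\<bar>x $ i\<bar> / 2)" if "y \<in> ball x \<rho>" for y
  proof -
    have "\<bar>(x - y) $ i\<bar> < \<rho>"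
      using that component_le_norm_cart[of "x - y" i] by (simp add: dist_norm)
    then show "\<bar>x $ i\<bar> / 2 < \<bar>y $ i\<bar>" "\<bar>y $ i\<bar> < 3 * (\<bar>x $ i\<bar> / 2)"
      using \<rho>[of i] by auto
  qed
  have *: False if "y \<in> ball x \<rho>" "y' \<in> ball x \<rho>" "exp_stretch u y = exp_stretch u' y'" "u' $ i + 2 \<le> u $ i"
    for y y' u u'
  proof -
    have "exp (- u $ i) * y $ i = exp (- u' $ i) * y' $ i"
      using that(3) by (metis exp_stretch_component)
    then have "exp (u $ i) * (exp (- u $ i) * y $ i) = exp (u $ i) * (exp (- u' $ i) * y' $ i)" by simp
    then have "y $ i = exp (u $ i - u' $ i) * y' $ i"
      by (simp add: exp_diff exp_minus field_simps)
    then have "\<bar>y $ i\<bar> = exp (u $ i - u' $ i) * \<bar>y' $ i\<bar>" by (simp add: abs_mult)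
    moreover have "3 \<le> exp (u $ i - u' $ i)"
      using exp_ge_add_one_self[of "u $ i - u' $ i"] that(4) by linarith
    then have "3 * \<bar>y' $ i\<bar> \<le> exp (u $ i - u' $ i) * \<bar>y' $ i\<bar>" by (rule mult_right_mono) simp
    ultimately show False using close(1)[OF that(2)] close(2)[OF that(1)] by linarith
  qed
  show ?thesis
  proof (rule ccontr)
    assume "\<not> ?thesis"
    then obtain y y' where "y \<in> ball x \<rho>" "y' \<in> ball x \<rho>" "exp_stretch w y = exp_stretch w' y'" by force
    moreover have "w' $ i + 2 \<le> w $ i \<or> w $ i + 2 \<le> w' $ i" using sep by linarith
    ultimately show False using *[of y y' w w'] *[of y' y w' w] by fastforce
  qed
qed

text \<open>The common estimate for both claims, with \<epsilon> written as
  \<open>exp (- (T * (b + \<eta> / 4)))\<close>. \<open>W\<close> is any finite separated set of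
  weights near \<open>T *\<^sub>R w0\<close> that are constant on \<open>F\<close>: a singleton
  serves the first claim, a large set the second. \<open>C\<close> and \<open>r\<close> do not
  depend on \<open>W\<close>.\<close>

lemma sublevel_integral_weights_bound:
  fixes S :: "real ^ 'n::finite \<Rightarrow> real" and s :: "('n \<Rightarrow> nat) \<Rightarrow> real"
  assumes d: "0 < d" "vec d \<in> F" and fin: "finite {\<alpha>. multi_vec \<alpha> \<in> F}"
    and w0: "\<And>i. 0 < w0 $ i" "\<And>z. z \<in> F \<Longrightarrow> w0 \<bullet> z = b" and \<eta>: "0 < \<eta>"
    and gap: "\<And>\<alpha>. s \<alpha> \<noteq> 0 \<Longrightarrow> multi_vec \<alpha> \<notin> F \<Longrightarrow> b + \<eta> * (1 + real (sum \<alpha> UNIV)) \<le> w0 \<bullet> multi_vec \<alpha>"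
    and x: "\<And>i. x $ i \<noteq> 0" and gi: "abs_has_growth_index_at (face_poly s F) x (ereal a) q"
    and R: "0 < R" and sm: "(\<lambda>\<alpha>. \<bar>s \<alpha>\<bar> * R ^ sum \<alpha> UNIV) summable_on UNIV"
    and hs: "\<And>x. (\<And>i. \<bar>x $ i\<bar> \<le> R) \<Longrightarrow> ((\<lambda>\<alpha>. s \<alpha> * monomial_at x \<alpha>) has_sum S x) UNIV"
    and \<phi>: "\<phi> \<in> bump_functions (ball 0 R)"
  obtains C r where "0 < C" "0 < r"
    "\<forall>\<^sub>F T in at_top. \<forall>W. finite W \<longrightarrow>
       (\<forall>w\<in>W. norm (w - T *\<^sub>R w0) \<le> r * T \<and> (\<forall>z\<in>F. (w - T *\<^sub>R w0) \<bullet> (z - vec d) = 0)) \<longrightarrow>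
       (\<forall>w\<in>W. \<forall>w'\<in>W. w \<noteq> w' \<longrightarrow> (\<exists>i. 2 \<le> \<bar>w $ i - w' $ i\<bar>)) \<longrightarrow>
       C * T ^ q * (\<Sum>w\<in>W. exp (- (w \<bullet> vec d) / d) * exp (w \<bullet> vec d - T * (b + \<eta> / 4)) powr a)
         \<le> abs_sublevel_integral S \<phi> (exp (- (T * (b + \<eta> / 4))))"
proof -
  let ?v = "vec d :: real ^ 'n"
  let ?M = "\<Sum>\<^sub>\<infinity>\<alpha>. \<bar>s \<alpha>\<bar> * R ^ sum \<alpha> UNIV"
  obtain \<mu> where \<mu>: "0 < \<mu>" "\<And>i. \<mu> \<le> w0 $ i"
    using finite_uniform_lower_bound[of UNIV "\<lambda>i. w0 $ i"] w0(1) by auto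
  obtain \<rho>0 where \<rho>0: "0 < \<rho>0" "\<And>i. \<rho>0 \<le> \<bar>x $ i\<bar>"
    using finite_uniform_lower_bound[of UNIV "\<lambda>i. \<bar>x $ i\<bar>"] x by auto
  \<comment> \<open>\<open>\<rho>0 / 2\<close> is what disjointness of the images requires; the cap
    1 gives the bound \<open>B\<close>.\<close>
  define \<rho> where "\<rho> = min 1 (\<rho>0 / 2)"
  have \<rho>: "0 < \<rho>" "\<rho> \<le> 1" "\<And>i. 2 * \<rho> \<le> \<bar>x $ i\<bar>"
    using \<rho>0 by (auto simp: \<rho>_def min_def intro: order_trans)
  define B where "B = norm x + 1"
  have B: "0 < B" by (simp add: B_def add_nonneg_pos)
  have yB: "\<bar>y $ i\<bar> \<le> B" if "y \<in> ball x \<rho>" for y i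
  proof -
    have "norm y \<le> norm x + norm (x - y)"
      using norm_triangle_ineq4[of x "x - y"] by simp
    then show ?thesis
      using that \<rho>(2) component_le_norm_cart[of y i] by (simp add: B_def dist_norm)
  qed
  obtain C0 where C0: "0 < C0"
    "\<forall>\<^sub>F \<delta> in at_right 0. C0 * \<bar>ln \<delta>\<bar> ^ q * \<delta> powr a \<le> measure lborel {y \<in> ball x \<rho>. \<bar>face_poly s F y\<bar> < \<delta>}"
    using abs_growth_index_at_sublevel_measure[OF continuous_on_face_poly gi \<rho>(1)] by blast
  obtain \<delta>0 where \<delta>0: "0 < \<delta>0"
    "\<And>\<delta>. 0 < \<delta> \<Longrightarrow> \<delta> < \<delta>0 \<Longrightarrow> C0 * \<bar>ln \<delta>\<bar> ^ q * \<delta> powr a \<le> measure lborel {y \<in> ball x \<rho>. \<bar>face_poly s F y\<bar> < \<delta>}"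
    using C0(2) unfolding eventually_at_right_field by auto
  define \<kappa> where "\<kappa> = \<phi> 0 / 2"
  have \<kappa>: "0 < \<kappa>" "\<kappa> < \<phi> 0" using \<phi> by (auto simp: \<kappa>_def bump_functions_def)
  have "isCont \<phi> 0"
    using \<phi> smooth_continuous by (auto simp: bump_functions_def continuous_on_eq_continuous_at)
  then have "\<forall>\<^sub>F z in nhds 0. \<kappa> < \<phi> z"
    using \<kappa>(2) by (auto simp: isCont_def dest!: tendsto_at_iff_tendsto_nhds[THEN iffD1] order_tendstoD(1))
  then obtain r1 where r1: "0 < r1" "\<And>z. norm z < r1 \<Longrightarrow> \<kappa> < \<phi> z"
    by (auto simp: eventually_nhds_metric)
  \<comment> \<open>The first term keeps the coordinates of an admissible weight at least
    \<open>T * \<mu> / 2\<close>; the second limits the effect of a perturbation to an eighth of the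
    gap.\<close>
  define r where "r = min (\<mu> / 2) (\<eta> / (8 * (1 + norm ?v)))"
  have nv: "0 < 1 + norm ?v" by (simp add: add_pos_nonneg)
  have r: "0 < r" "r \<le> \<mu> / 2" "r * (1 + norm ?v) \<le> \<eta> / 8"
  proof -
    show "0 < r" using \<mu>(1) \<eta> nv by (simp add: r_def)
    show "r \<le> \<mu> / 2" unfolding r_def by (rule min.cobounded1)
    have "r * (1 + norm ?v) \<le> \<eta> / (8 * (1 + norm ?v)) * (1 + norm ?v)"
      using nv by (intro mult_right_mono) (auto simp: r_def)
    moreover have "\<eta> / (8 * c) * c = \<eta> / 8" if "0 < c" for c using that by simp
    ultimately show "r * (1 + norm ?v) \<le> \<eta> / 8" using nv by (simp only:)
  qed
  \<comment> \<open>\<kappa> bounds \<phi> near the origin, \<open>\<eta> / 8\<close> comes from the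
    logarithm of the level, and the power of 1/2 from using half the level.\<close>
  define C where "C = \<kappa> * (C0 * (\<eta> / 8) ^ q * (1 / 2) powr a)"
  have C: "0 < C" using \<kappa> C0 \<eta> by (simp add: C_def)
  \<comment> \<open>After \<open>1 \<le> T\<close>, the conditions in turn bring the shrunken
    \<open>y\<close> into the box, make the series remainder small, place the stretched points near
    the origin, and bring the level into the range of the volume bound.\<close>
  have ev: "\<forall>\<^sub>F T in at_top. 1 \<le> T \<and> B * exp (- (\<eta> / 2 * T)) < R \<and> ?M * exp (- (\<eta> / 8 * T)) < 1 / 2 \<and>
      real CARD('n) * B * exp (- (\<mu> / 2 * T)) < min r1 R \<and> 1 / 2 * exp (- (\<eta> / 8 * T)) < \<delta>0"
    using \<eta> \<mu>(1) R r1(1) \<delta>0(1)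
    by (intro eventually_conj eventually_exp_decay eventually_ge_at_top) auto
  show ?thesis
  proof (rule that[OF C r(1)], use ev in eventually_elim, intro allI impI)
    fix T :: real and W :: "(real ^ 'n) set"
    assume T: "1 \<le> T \<and> B * exp (- (\<eta> / 2 * T)) < R \<and> ?M * exp (- (\<eta> / 8 * T)) < 1 / 2 \<and>
        real CARD('n) * B * exp (- (\<mu> / 2 * T)) < min r1 R \<and> 1 / 2 * exp (- (\<eta> / 8 * T)) < \<delta>0"
      and W: "finite W"
      and adm: "\<forall>w\<in>W. norm (w - T *\<^sub>R w0) \<le> r * T \<and> (\<forall>z\<in>F. (w - T *\<^sub>R w0) \<bullet> (z - ?v) = 0)"
      and sep: "\<forall>w\<in>W. \<forall>w'\<in>W. w \<noteq> w' \<longrightarrow> (\<exists>i. 2 \<le> \<bar>w $ i - w' $ i\<bar>)"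
    have T0: "0 < T" using T by linarith
    define \<epsilon> where "\<epsilon> = exp (- (T * (b + \<eta> / 4)))"
    \<comment> \<open>Dividing |S| < \<epsilon> by the common factor
      \<open>exp (- (w \<bullet> ?v))\<close> gives this level for the face polynomial; half of it
      is reserved for the remainder.\<close>
    define \<delta> where "\<delta> = (\<lambda>w. exp (w \<bullet> ?v - T * (b + \<eta> / 4)))"
    define E where "E = (\<lambda>w. {y \<in> ball x \<rho>. \<bar>face_poly s F y\<bar> < \<delta> w / 2})"
    have wF: "w \<bullet> z = w \<bullet> ?v" if "w \<in> W" "z \<in> F" for w z
    proof -
      have "(w - T *\<^sub>R w0) \<bullet> (z - ?v) = 0" using adm that by blast
      then show ?thesis using w0(2)[OF that(2)] w0(2)[OF d(2)] by (simp add: inner_diff_left inner_diff_right)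
    qed
    have inner_le: "\<bar>(w - T *\<^sub>R w0) \<bullet> z\<bar> \<le> r * T * norm z" if "w \<in> W" for w z
    proof -
      have "\<bar>(w - T *\<^sub>R w0) \<bullet> z\<bar> \<le> norm (w - T *\<^sub>R w0) * norm z" by (rule Cauchy_Schwarz_ineq2)
      also have "\<dots> \<le> r * T * norm z" using adm that by (intro mult_right_mono) auto
      finally show ?thesis .
    qed
    have c_close: "\<bar>w \<bullet> ?v - T * b\<bar> \<le> T * \<eta> / 8" if "w \<in> W" for w
    proof -
      have "w \<bullet> ?v - T * b = (w - T *\<^sub>R w0) \<bullet> ?v"
        using w0(2)[OF d(2)] by (simp add: inner_diff_left)
      moreover have "r * T * norm ?v \<le> T * (r * (1 + norm ?v))"
        using T0 r(1) by (simp add: algebra_simps)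
      moreover have "T * (r * (1 + norm ?v)) \<le> T * (\<eta> / 8)"
        using T0 r(3) by (intro mult_left_mono) auto
      ultimately show ?thesis using inner_le[OF that, of ?v] by simp
    qed
    have w_ge: "T * \<mu> / 2 \<le> w $ i" if "w \<in> W" for w i
    proof -
      have "\<bar>(w - T *\<^sub>R w0) $ i\<bar> \<le> r * T"
        using adm that component_le_norm_cart[of "w - T *\<^sub>R w0" i] by force
      moreover have "r * T \<le> \<mu> / 2 * T" using r(2) T0 by (intro mult_right_mono) auto
      moreover have "T * \<mu> \<le> T * w0 $ i" using \<mu>(2) T0 by (intro mult_left_mono) auto
      ultimately show ?thesis by (simp add: abs_le_iff algebra_simps)
    qed
    \<comment> \<open>The perturbation changes the pairing with
      \<open>multi_vec \<alpha> - ?v\<close> by at most an eighth of the gap, so at least half of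
      the gap survives.\<close>
    have gap': "w \<bullet> ?v + T * \<eta> / 2 * (1 + real (sum \<alpha> UNIV)) \<le> w \<bullet> multi_vec \<alpha>"
      if w: "w \<in> W" and \<alpha>: "s \<alpha> \<noteq> 0" "multi_vec \<alpha> \<notin> F" for w \<alpha>
    proof -
      define l where "l = real (sum \<alpha> UNIV)"
      have l: "0 \<le> l" by (simp add: l_def sum_nonneg)
      have "norm (multi_vec \<alpha> :: real ^ 'n) \<le> l"
        using norm_le_l1_cart[of "multi_vec \<alpha>"] by (simp add: multi_vec_def l_def)
      then have "norm (multi_vec \<alpha> - ?v) \<le> l + norm ?v"
        using norm_triangle_ineq4[of "multi_vec \<alpha>" ?v] by linarith
      also have "\<dots> \<le> (1 + norm ?v) * (1 + l)"
        using l by (simp add: algebra_simps)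
      finally have "r * T * norm (multi_vec \<alpha> - ?v) \<le> r * T * ((1 + norm ?v) * (1 + l))"
        using r(1) T0 by (intro mult_left_mono) auto
      also have "\<dots> = r * (1 + norm ?v) * (T * (1 + l))" by (simp add: mult_ac)
      also have "\<dots> \<le> \<eta> / 8 * (T * (1 + l))"
        using r(3) T0 l by (intro mult_right_mono) auto
      finally have 1: "- (\<eta> * (T * (1 + l)) / 8) \<le> (w - T *\<^sub>R w0) \<bullet> (multi_vec \<alpha> - ?v)"
        using inner_le[OF w, of "multi_vec \<alpha> - ?v"] by linarith
      have "T * (b + \<eta> * (1 + l)) \<le> T * (w0 \<bullet> multi_vec \<alpha>)"
        using gap[OF \<alpha>] T0 unfolding l_def by (intro mult_left_mono) auto
      then have 2: "T * b + \<eta> * (T * (1 + l)) \<le> T * (w0 \<bullet> multi_vec \<alpha>)"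
        by (simp add: algebra_simps)
      have 3: "0 \<le> \<eta> * (T * (1 + l))" using \<eta> T0 l by simp
      have "w \<bullet> multi_vec \<alpha> - w \<bullet> ?v
          = (w - T *\<^sub>R w0) \<bullet> (multi_vec \<alpha> - ?v) + T * (w0 \<bullet> multi_vec \<alpha>) - T * b"
        using w0(2)[OF d(2)] by (simp add: inner_diff_left inner_diff_right)
      \<comment> \<open>Replacing the products by variables leaves a purely linear
        inequality.\<close>
      moreover have "C + X / 2 \<le> A"
        if "- (X / 8) \<le> P" "D' + X \<le> D" "0 \<le> X" "A - C = P + D - D'" for A C X P D D' :: real
        using that by linarith
      ultimately have "w \<bullet> ?v + \<eta> * (T * (1 + l)) / 2 \<le> w \<bullet> multi_vec \<alpha>"
        using 1 2 3 by blast
      then show ?thesis unfolding l_def[symmetric] by (simp add: mult_ac)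
    qed
    \<comment> \<open>The offset \<open>\<eta> / 4\<close> exceeds the deviation
      \<open>\<eta> / 8\<close> of \<open>w \<bullet> ?v\<close> per unit of \<open>T\<close>: the
      level decays, but more slowly than the remainder, whose rate is
      \<open>\<eta> / 2\<close>.\<close>
    have \<delta>: "0 < \<delta> w" "exp (- (3 * \<eta> / 8 * T)) \<le> \<delta> w" "\<delta> w \<le> exp (- (\<eta> / 8 * T))" if "w \<in> W" for w
    proof -
      have "\<delta> w = exp ((w \<bullet> ?v - T * b) - 2 * (T * \<eta> / 8))"
        by (simp add: \<delta>_def algebra_simps)
      moreover have "- (3 * \<eta> / 8 * T) = - (T * \<eta> / 8) - 2 * (T * \<eta> / 8)"
        "- (\<eta> / 8 * T) = T * \<eta> / 8 - 2 * (T * \<eta> / 8)" by (simp_all add: algebra_simps)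
      ultimately show "0 < \<delta> w" "exp (- (3 * \<eta> / 8 * T)) \<le> \<delta> w" "\<delta> w \<le> exp (- (\<eta> / 8 * T))"
        using c_close[OF that] unfolding exp_le_cancel_iff abs_le_iff by (simp_all only: exp_le_cancel_iff exp_gt_zero) linarith+
    qed
    have small: "norm (exp_stretch w y) < min r1 R" if w: "w \<in> W" and y: "y \<in> ball x \<rho>" for w y
    proof -
      have "norm (exp_stretch w y) \<le> (\<Sum>i\<in>UNIV. \<bar>exp_stretch w y $ i\<bar>)" by (rule norm_le_l1_cart)
      also have "\<dots> \<le> (\<Sum>i\<in>(UNIV :: 'n set). exp (- (\<mu> / 2 * T)) * B)"
        unfolding exp_stretch_component abs_mult abs_exp_cancel
        using w_ge[OF w] yB[OF y] by (intro sum_mono mult_mono) (auto simp: mult.commute)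
      also have "\<dots> < min r1 R" using T by (simp add: mult_ac)
      finally show ?thesis .
    qed
    have S_small: "\<bar>S (exp_stretch w y)\<bar> < \<epsilon>" if w: "w \<in> W" and y: "y \<in> E w" for w y
    proof -
      define c where "c = w \<bullet> ?v"
      have yb: "y \<in> ball x \<rho>" "\<bar>face_poly s F y\<bar> < \<delta> w / 2" using y by (auto simp: E_def)
      have "((\<lambda>\<alpha>. s \<alpha> * monomial_at (exp_stretch w y) \<alpha>) has_sum S (exp_stretch w y)) UNIV"
      proof (rule hs)
        show "\<bar>exp_stretch w y $ i\<bar> \<le> R" for i
          using small[OF w yb(1)] component_le_norm_cart[of "exp_stretch w y" i] by linarith
      qed
      moreover have "exp (- (T * \<eta> / 2)) * \<bar>y $ i\<bar> \<le> R" for i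
      proof -
        have "exp (- (T * \<eta> / 2)) * \<bar>y $ i\<bar> \<le> exp (- (T * \<eta> / 2)) * B"
          using yB[OF yb(1)] by (intro mult_left_mono) auto
        also have "\<dots> \<le> R" using T by (simp add: mult_ac)
        finally show ?thesis .
      qed
      ultimately have "\<bar>S (exp_stretch w y) - exp (- c) * face_poly s F y\<bar> \<le> exp (- c) * (exp (- (T * \<eta> / 2)) * ?M)"
        unfolding c_def using R sm fin wF[OF w] gap'[OF w]
        by (intro power_series_exp_stretch_approx[where F=F]) auto
      moreover have "exp (- (T * \<eta> / 2)) * ?M < \<delta> w / 2"
      proof -
        \<comment> \<open>The rate is split as 1/2 = 3/8 + 1/8: the first factor is at most the
          level, the second beats the constant \<open>?M\<close>.\<close>
        have "exp (- (T * \<eta> / 2)) * ?M = exp (- (3 * \<eta> / 8 * T)) * (?M * exp (- (\<eta> / 8 * T)))"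
          by (simp add: field_simps flip: exp_add)
        also have "\<dots> < exp (- (3 * \<eta> / 8 * T)) * (1 / 2)"
          using T by (intro mult_strict_left_mono) auto
        also have "\<dots> \<le> \<delta> w / 2" using \<delta>(2)[OF w] by simp
        finally show ?thesis .
      qed
      then have "exp (- c) * (exp (- (T * \<eta> / 2)) * ?M) < exp (- c) * (\<delta> w / 2)"
        by (intro mult_strict_left_mono) auto
      moreover have "\<bar>exp (- c) * face_poly s F y\<bar> < exp (- c) * (\<delta> w / 2)"
        unfolding abs_mult abs_exp_cancel using yb(2) by (intro mult_strict_left_mono) auto
      moreover have "exp (- c) * (\<delta> w / 2) + exp (- c) * (\<delta> w / 2) = \<epsilon>"
        by (simp add: \<delta>_def \<epsilon>_def c_def field_simps flip: exp_add)
      ultimately show ?thesis by linarith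
    qed
    \<comment> \<open>The logarithm of the level is at least \<open>\<eta> / 8 * T\<close> in
      absolute value, which turns the multiplicity into the power \<open>T ^ q\<close>.\<close>
    have meas: "C0 * (\<eta> / 8 * T) ^ q * (1 / 2 * \<delta> w) powr a \<le> measure lborel (E w)" if w: "w \<in> W" for w
    proof -
      have "\<delta> w / 2 < \<delta>0" using \<delta>(3)[OF w] T by linarith
      then have 1: "C0 * \<bar>ln (\<delta> w / 2)\<bar> ^ q * (\<delta> w / 2) powr a \<le> measure lborel (E w)"
        unfolding E_def using \<delta>(1)[OF w] by (intro \<delta>0(2)) auto
      have "\<delta> w / 2 \<le> exp (- (\<eta> / 8 * T))" using \<delta>(1,3)[OF w] by linarith
      then have "ln (\<delta> w / 2) \<le> ln (exp (- (\<eta> / 8 * T)))"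
        using \<delta>(1)[OF w] by (subst ln_le_cancel_iff) auto
      then have "ln (\<delta> w / 2) \<le> - (\<eta> / 8 * T)" by (simp only: ln_exp)
      then have "\<eta> / 8 * T \<le> \<bar>ln (\<delta> w / 2)\<bar>" by linarith
      then have "(\<eta> / 8 * T) ^ q \<le> \<bar>ln (\<delta> w / 2)\<bar> ^ q"
        using \<eta> T0 by (intro power_mono) auto
      then have "C0 * (\<eta> / 8 * T) ^ q * (1 / 2 * \<delta> w) powr a \<le> C0 * \<bar>ln (\<delta> w / 2)\<bar> ^ q * (\<delta> w / 2) powr a"
        using C0(1) by (simp add: mult_left_mono mult_right_mono)
      with 1 show ?thesis by linarith
    qed
    have "\<kappa> * (\<Sum>w\<in>W. exp (- (\<Sum>i\<in>UNIV. w $ i)) * measure lborel (E w)) \<le> abs_sublevel_integral S \<phi> \<epsilon>"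
    proof (rule abs_sublevel_integral_ge[OF _ _ _ \<phi> W])
      show "continuous_on (ball 0 R) S"
      proof (rule continuous_on_subset[OF continuous_on_power_series_box[OF sm hs]])
        show "ball 0 R \<subseteq> {x. \<forall>i. \<bar>x $ i\<bar> \<le> R}"
          using component_le_norm_cart order_trans less_imp_le by fastforce
      qed
      show "open (E w)" for w
        unfolding E_def by (rule open_sublevel_in_ball[OF continuous_on_face_poly])
      show "bounded (E w)" for w
        by (rule bounded_subset[OF bounded_ball[of x \<rho>]]) (auto simp: E_def)
      show "exp_stretch w ` E w \<inter> exp_stretch w' ` E w' = {}" if ww: "w \<in> W" "w' \<in> W" "w \<noteq> w'" for w w'
      proof -
        obtain i where "2 \<le> \<bar>w $ i - w' $ i\<bar>" using sep ww by blast
        from exp_stretch_images_disjoint[OF \<rho>(3) this]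
        have "exp_stretch w ` ball x \<rho> \<inter> exp_stretch w' ` ball x \<rho> = {}" .
        moreover have "E w \<subseteq> ball x \<rho>" for w by (auto simp: E_def)
        ultimately show ?thesis by blast
      qed
      show "\<kappa> \<le> \<phi> (exp_stretch w y)" if "w \<in> W" "y \<in> E w" for w y
        using small[OF that(1), of y] that(2) r1(2) by (force simp: E_def)
    qed (use S_small \<kappa> in auto)
    moreover have "C * T ^ q * (\<Sum>w\<in>W. exp (- (w \<bullet> ?v) / d) * \<delta> w powr a)
        \<le> \<kappa> * (\<Sum>w\<in>W. exp (- (\<Sum>i\<in>UNIV. w $ i)) * measure lborel (E w))"
    proof -
      \<comment> \<open>The diagonal point enters here: all coordinates of \<open>?v\<close> equal
        \<open>d\<close>, so the exponent of the Jacobian is \<open>w \<bullet> ?v / d\<close> up to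
        sign.\<close>
      have "w \<bullet> ?v / d = (\<Sum>i\<in>UNIV. w $ i)" for w
        using d(1) by (simp add: inner_vec_def flip: sum_distrib_right)
      then have vd: "exp (- (w \<bullet> ?v) / d) = exp (- (\<Sum>i\<in>UNIV. w $ i))" for w by simp
      have "C * T ^ q * (\<Sum>w\<in>W. exp (- (w \<bullet> ?v) / d) * \<delta> w powr a)
          = \<kappa> * (\<Sum>w\<in>W. exp (- (\<Sum>i\<in>UNIV. w $ i)) * (C0 * (\<eta> / 8 * T) ^ q * (1 / 2 * \<delta> w) powr a))"
        unfolding sum_distrib_left vd
        by (intro sum.cong refl) (simp add: C_def power_mult_distrib powr_mult power_divide powr_divide \<delta>_def mult_ac)
      also have "\<dots> \<le> \<kappa> * (\<Sum>w\<in>W. exp (- (\<Sum>i\<in>UNIV. w $ i)) * measure lborel (E w))"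
        using \<kappa>(1) meas by (intro mult_left_mono sum_mono) auto
      finally show ?thesis .
    qed
    ultimately show "C * T ^ q * (\<Sum>w\<in>W. exp (- (w \<bullet> ?v) / d) * exp (w \<bullet> ?v - T * (b + \<eta> / 4)) powr a)
         \<le> abs_sublevel_integral S \<phi> (exp (- (T * (b + \<eta> / 4))))"
      unfolding \<delta>_def \<epsilon>_def by linarith
  qed
qed

section \<open>Range of the index, positivity of the distance, and the space of
  perturbations\<close>

text \<open>A leading exponent is real or plus infinity; the existence of a bump function keeps the
  quantifier in the definition from being vacuous.\<close>

lemma abs_growth_index_at_not_MInf:
  assumes "abs_has_growth_index_at f p a m"
  shows "a \<noteq> - \<infinity>"
proof -
  have *: "a \<noteq> - \<infinity>" if gi: "has_growth_index f a m" for f :: "real ^ 'n::finite \<Rightarrow> real" and a m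
  proof -
    obtain r U where U: "open U" "0 \<in> U"
      "\<forall>\<phi>\<in>bump_functions U. \<exists>c. has_log_power_expansion CARD('n) (pos_sublevel_integral f \<phi>) r c \<and>
           leading_term CARD('n) r c a m"
      using gi unfolding has_growth_index_def by blast
    obtain \<phi> where "\<phi> \<in> bump_functions U" using bump_function_le_1_exists[OF U(1,2)] .
    with U(3) obtain c where "leading_term CARD('n) r c a m" by blast
    then show ?thesis by (auto simp: leading_term_def)
  qed
  show ?thesis
    using assms * by (auto simp: abs_has_growth_index_at_def abs_has_growth_index_def min_def split: if_splits)
qed

text \<open>Every exponent with nonzero coefficient has degree at least 1, and a half-space is
  convex. For the diagonal point this yields d > 0.\<close>

lemma newton_polyhedron_sum_ge_1:
  assumes s: "s (\<lambda>_. 0) = 0" and z: "z \<in> newton_polyhedron s"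
  shows "1 \<le> (\<Sum>i\<in>UNIV. z $ i)"
proof -
  have eq: "{z :: real ^ 'a. 1 \<le> (\<Sum>i\<in>UNIV. z $ i)} = {z. vec 1 \<bullet> z \<ge> 1}"
    by (simp add: inner_vec_def)
  have "newton_polyhedron s \<subseteq> {z. 1 \<le> (\<Sum>i\<in>UNIV. z $ i)}"
    unfolding newton_polyhedron_def
  proof (rule hull_minimal)
    show "convex {z :: real ^ 'a. 1 \<le> (\<Sum>i\<in>UNIV. z $ i)}"
      unfolding eq by (rule convex_halfspace_ge)
    show "(\<Union>\<alpha>\<in>{\<alpha>. s \<alpha> \<noteq> 0}. {x :: real ^ 'a. \<forall>i. real (\<alpha> i) \<le> x $ i}) \<subseteq> {z. 1 \<le> (\<Sum>i\<in>UNIV. z $ i)}"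
    proof clarify
      fix \<alpha> and x :: "real ^ 'a"
      assume \<alpha>: "s \<alpha> \<noteq> 0" "\<forall>i. real (\<alpha> i) \<le> x $ i"
      then have "\<alpha> \<noteq> (\<lambda>_. 0)" using s by auto
      then obtain i where i: "\<alpha> i \<noteq> 0" by auto
      then have "1 \<le> sum \<alpha> UNIV"
        using member_le_sum[of i UNIV \<alpha>] by simp
      then have "real 1 \<le> real (sum \<alpha> UNIV)" by (rule of_nat_mono)
      also have "\<dots> \<le> (\<Sum>i\<in>UNIV. x $ i)"
        unfolding of_nat_sum using \<alpha>(2) by (intro sum_mono) auto
      finally show "1 \<le> (\<Sum>i\<in>UNIV. x $ i)" by simp
    qed
  qed
  with z show ?thesis by blast
qed

lemma has_taylor_expansion_0_coeff:
  fixes s :: "('n::finite \<Rightarrow> nat) \<Rightarrow> real"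
  assumes "has_taylor_expansion f s p"
  shows "s (\<lambda>_. 0) = f p"
proof -
  have "((\<lambda>\<alpha>. s \<alpha> * monomial_at (0 :: real ^ 'n) \<alpha>) has_sum f p) UNIV"
    using assms unfolding has_taylor_expansion_def by (auto dest: eventually_nhds_x_imp_x)
  moreover have "((\<lambda>\<alpha>. s \<alpha> * monomial_at (0 :: real ^ 'n) \<alpha>) has_sum s (\<lambda>_. 0)) UNIV"
  proof (rule has_sum_cong_neutral[THEN iffD1])
    show "((\<lambda>\<alpha>. s \<alpha>) has_sum s (\<lambda>_. 0)) {\<lambda>_. 0}"
      by (simp add: has_sum_finite_iff)
    show "s \<alpha> = s \<alpha> * monomial_at (0 :: real ^ 'n) \<alpha>" if "\<alpha> \<in> {\<lambda>_. 0} \<inter> UNIV" for \<alpha>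
      using that by (simp add: monomial_at_def)
    show "s \<alpha> * monomial_at (0 :: real ^ 'n) \<alpha> = 0" if "\<alpha> \<in> UNIV - {\<lambda>_. 0}" for \<alpha>
    proof -
      have "\<exists>i. \<alpha> i \<noteq> 0" using that by auto
      then show ?thesis by (auto simp: monomial_at_def)
    qed
  qed auto
  ultimately show ?thesis using has_sum_unique by metis
qed

text \<open>The set is the orthogonal complement of the span of \<open>F - v\<close>. Its elements
  are the perturbations that keep a weight constant on \<open>F\<close>.\<close>

lemma dim_orthogonal_to_directions:
  fixes F :: "(real ^ 'n::finite) set"
  assumes v: "v \<in> F" and k: "aff_dim F = int k"
  shows "subspace {u. \<forall>z\<in>F. u \<bullet> (z - v) = 0}" "dim {u. \<forall>z\<in>F. u \<bullet> (z - v) = 0} = CARD('n) - k"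
proof -
  let ?E = "{u. \<forall>z\<in>F. u \<bullet> (z - v) = 0}" and ?D = "(\<lambda>z. z - v) ` F"
  show "subspace ?E" by (auto simp: subspace_def inner_add_left)
  have "aff_dim F = int (dim ?D)"
    using v by (intro aff_dim_eq_dim_subtract hull_inc)
  then have "dim (span ?D) = k" using k by simp
  moreover have "?E = {y \<in> UNIV. \<forall>x\<in>span ?D. orthogonal x y}"
  proof (intro set_eqI iffI)
    fix u assume "u \<in> ?E"
    then have "\<And>y. y \<in> ?D \<Longrightarrow> orthogonal u y" by (auto simp: orthogonal_def)
    then show "u \<in> {y \<in> UNIV. \<forall>x\<in>span ?D. orthogonal x y}"
      using orthogonal_to_span[of _ ?D u] by (auto simp: orthogonal_commute)
  next
    fix u assume "u \<in> {y \<in> UNIV. \<forall>x\<in>span ?D. orthogonal x y}"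
    then show "u \<in> ?E"
      using span_base[of _ ?D] by (auto simp: orthogonal_def inner_commute)
  qed
  ultimately show "dim ?E = CARD('n) - k"
    using dim_subspace_orthogonal_to_vectors[of "span ?D" UNIV] by simp
qed

lemma filterlim_neg_ln_div_at_top:
  assumes "0 < (g :: real)"
  shows "filterlim (\<lambda>\<epsilon>. - ln \<epsilon> / g) at_top (at_right 0)"
proof -
  have "filterlim (\<lambda>\<epsilon>. 1 / g * - ln \<epsilon>) at_top (at_right 0)"
    using assms
    by (intro filterlim_tendsto_pos_mult_at_top[OF tendsto_const] filterlim_compose[OF filterlim_uminus_at_top_at_bot ln_at_0]) auto
  then show ?thesis by simp
qed

section \<open>Assembly of the two bounds\<close>

theorem theorem1p4:
  fixes S :: "real ^ 'n::finite \<Rightarrow> real"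
    and V :: "(real ^ 'n) set"
    and s :: "('n \<Rightarrow> nat) \<Rightarrow> real"
    and d :: real
    and F :: "(real ^ 'n) set"
    and k :: nat
  assumes "open V" and "0 \<in> V" and "real_analytic_on S V"
    and "has_taylor_expansion S s 0"
    and "\<not> (\<forall>\<^sub>F x in nhds 0. S x = 0)"
    and "S 0 = 0"
    and "GDERIV S 0 :> 0"
    and "d = newton_distance s"
    and "is_central_face s F"
    and "aff_dim F = int k"
    and "compact F"
  shows "\<exists>U. open U \<and> 0 \<in> U \<and> (\<forall>\<phi>\<in>bump_functions U.
     ((\<exists>x a q. (\<forall>i. x $ i \<noteq> 0) \<and> abs_has_growth_index_at (face_poly s F) x a q \<and>
          a < ereal (1 / d)) \<longrightarrow>
        (\<exists>a'<1 / d. \<exists>C>0. \<forall>\<^sub>F \<epsilon> in at_right 0.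
           abs_sublevel_integral S \<phi> \<epsilon> > C * \<epsilon> powr a')) \<and>
     (\<forall>q. (\<exists>x. (\<forall>i. x $ i \<noteq> 0) \<and>
          abs_has_growth_index_at (face_poly s F) x (ereal (1 / d)) q) \<longrightarrow>
        (\<exists>C>0. \<forall>\<^sub>F \<epsilon> in at_right 0.
           abs_sublevel_integral S \<phi> \<epsilon> >
             C * \<bar>ln \<epsilon>\<bar> ^ (CARD('n) - k + q) * \<epsilon> powr (1 / d))))"
proof -
  let ?v = "vec d :: real ^ 'n"
  have F: "F face_of newton_polyhedron s" "?v \<in> rel_interior F"
    using assms(8,9) by (auto simp: is_central_face_def)
  have vF: "?v \<in> F" using F(2) rel_interior_subset by blast
  have "s (\<lambda>_. 0) = 0" using has_taylor_expansion_0_coeff[OF assms(4)] assms(6) by simp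
  moreover have "?v \<in> newton_polyhedron s" using F(1) vF face_of_imp_subset by blast
  ultimately have "1 \<le> real CARD('n) * d" using newton_polyhedron_sum_ge_1[of s ?v] by simp
  then have d: "0 < d" by (smt (verit) mult_nonneg_nonpos of_nat_0_le_iff)
  have bdd: "bounded F" using assms(11) by (rule compact_imp_bounded)
  have fin: "finite {\<alpha>. multi_vec \<alpha> \<in> F}" using bdd by (rule finite_multi_indices_in_bounded)
  obtain w0 b \<eta> where w0: "\<And>i. 0 < w0 $ i" "\<And>z. z \<in> F \<Longrightarrow> w0 \<bullet> z = b" and \<eta>: "0 < \<eta>"
    and gap: "\<And>\<alpha>. s \<alpha> \<noteq> 0 \<Longrightarrow> multi_vec \<alpha> \<notin> F \<Longrightarrow> b + \<eta> * (1 + real (sum \<alpha> UNIV)) \<le> w0 \<bullet> multi_vec \<alpha>"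
    using bounded_face_weight[OF F(1) _ bdd] vF by blast
  have "0 < (\<Sum>i\<in>UNIV. w0 $ i * d)"
    using w0(1) d by (intro sum_pos) auto
  then have b: "0 < b" using w0(2)[OF vF] by (simp add: inner_vec_def)
  \<comment> \<open>With \<epsilon> = exp(-T g), the parameter \<open>T\<close> is
    \<open>- ln \<epsilon> / g\<close> and tends to infinity.\<close>
  define g where "g = b + \<eta> / 4"
  have g: "0 < g" using b \<eta> by (simp add: g_def)
  obtain R where R: "0 < R" and sm: "(\<lambda>\<alpha>. \<bar>s \<alpha>\<bar> * R ^ sum \<alpha> UNIV) summable_on UNIV"
    and hs: "\<And>x. (\<And>i. \<bar>x $ i\<bar> \<le> R) \<Longrightarrow> ((\<lambda>\<alpha>. s \<alpha> * monomial_at x \<alpha>) has_sum S x) UNIV"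
    using has_taylor_expansion_box[OF assms(4)] by blast
  have bound: "\<exists>C r. 0 < C \<and> 0 < r \<and> (\<forall>\<^sub>F T in at_top. \<forall>W. finite W \<longrightarrow>
       (\<forall>w\<in>W. norm (w - T *\<^sub>R w0) \<le> r * T \<and> (\<forall>z\<in>F. (w - T *\<^sub>R w0) \<bullet> (z - ?v) = 0)) \<longrightarrow>
       (\<forall>w\<in>W. \<forall>w'\<in>W. w \<noteq> w' \<longrightarrow> (\<exists>i. 2 \<le> \<bar>w $ i - w' $ i\<bar>)) \<longrightarrow>
       C * T ^ q * (\<Sum>w\<in>W. exp (- (w \<bullet> ?v) / d) * exp (w \<bullet> ?v - T * g) powr a)
         \<le> abs_sublevel_integral S \<phi> (exp (- (T * g))))"
    if hyp: "\<phi> \<in> bump_functions (ball 0 R)" "\<And>i. x $ i \<noteq> 0" "abs_has_growth_index_at (face_poly s F) x (ereal a) q"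
    for \<phi> x a q
  proof -
    obtain C r where "0 < C" "0 < r" "\<forall>\<^sub>F T in at_top. \<forall>W. finite W \<longrightarrow>
       (\<forall>w\<in>W. norm (w - T *\<^sub>R w0) \<le> r * T \<and> (\<forall>z\<in>F. (w - T *\<^sub>R w0) \<bullet> (z - ?v) = 0)) \<longrightarrow>
       (\<forall>w\<in>W. \<forall>w'\<in>W. w \<noteq> w' \<longrightarrow> (\<exists>i. 2 \<le> \<bar>w $ i - w' $ i\<bar>)) \<longrightarrow>
       C * T ^ q * (\<Sum>w\<in>W. exp (- (w \<bullet> ?v) / d) * exp (w \<bullet> ?v - T * g) powr a)
         \<le> abs_sublevel_integral S \<phi> (exp (- (T * g)))"
      unfolding g_def by (rule sublevel_integral_weights_bound[OF d vF fin w0 \<eta> gap hyp(2,3) R sm hs hyp(1)])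
    then show ?thesis by (intro exI[of _ C] exI[of _ r] conjI)
  qed
  have lim: "filterlim (\<lambda>\<epsilon>. - ln \<epsilon> / g) at_top (at_right 0)" by (rule filterlim_neg_ln_div_at_top[OF g])
  show ?thesis
  \<comment> \<open>The ball in which the Taylor series converges serves all \<phi> at once; only
    the constants and the range of \<epsilon> depend on \<phi>.\<close>
  proof (intro exI[of _ "ball 0 R"] conjI ballI impI allI)
    show "0 \<in> ball (0 :: real ^ 'n) R" using R by simp
  next
    fix \<phi> :: "real ^ 'n \<Rightarrow> real" assume \<phi>: "\<phi> \<in> bump_functions (ball 0 R)"
    assume "\<exists>x a q. (\<forall>i. x $ i \<noteq> 0) \<and> abs_has_growth_index_at (face_poly s F) x a q \<and> a < ereal (1 / d)"
    then obtain x a' q where x: "\<And>i. x $ i \<noteq> 0" "abs_has_growth_index_at (face_poly s F) x a' q" "a' < ereal (1 / d)"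
      by blast
    then obtain a where a: "a' = ereal a" using abs_growth_index_at_not_MInf[OF x(2)] by (cases a') auto
    \<comment> \<open>For the weight \<open>T *\<^sub>R w0\<close> the decay rate is
      \<open>b / d + a * (\<eta> / 4)\<close>; divided by \<open>g\<close> it is the average of 1/d
      and \<open>a\<close> with weights \<open>b\<close> and \<open>\<eta> / 4\<close>, hence below
      1/d.\<close>
    define a1 where "a1 = (b / d + a * (\<eta> / 4)) / g"
    have "a * (\<eta> / 4) < 1 / d * (\<eta> / 4)"
      using x(3) \<eta> unfolding a by (intro mult_strict_right_mono) auto
    moreover have "1 / d * g = b / d + 1 / d * (\<eta> / 4)" by (simp add: g_def add_divide_distrib)
    ultimately have "b / d + a * (\<eta> / 4) < 1 / d * g" by linarith
    then have a1: "a1 < 1 / d" using g by (simp add: a1_def pos_divide_less_eq)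
    obtain C r where C: "0 < C" "0 < r" and ev: "\<forall>\<^sub>F T in at_top. \<forall>W. finite W \<longrightarrow>
       (\<forall>w\<in>W. norm (w - T *\<^sub>R w0) \<le> r * T \<and> (\<forall>z\<in>F. (w - T *\<^sub>R w0) \<bullet> (z - ?v) = 0)) \<longrightarrow>
       (\<forall>w\<in>W. \<forall>w'\<in>W. w \<noteq> w' \<longrightarrow> (\<exists>i. 2 \<le> \<bar>w $ i - w' $ i\<bar>)) \<longrightarrow>
       C * T ^ q * (\<Sum>w\<in>W. exp (- (w \<bullet> ?v) / d) * exp (w \<bullet> ?v - T * g) powr a)
         \<le> abs_sublevel_integral S \<phi> (exp (- (T * g)))"
      using bound[OF \<phi> x(1) x(2)[unfolded a]] by blast
    have "\<forall>\<^sub>F T in at_top. C * exp (- (T * g)) powr a1 \<le> abs_sublevel_integral S \<phi> (exp (- (T * g)))"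
      using ev eventually_ge_at_top[of 1]
    proof eventually_elim
      case (elim T)
      have "C * T ^ q * (\<Sum>w\<in>{T *\<^sub>R w0}. exp (- (w \<bullet> ?v) / d) * exp (w \<bullet> ?v - T * g) powr a)
         \<le> abs_sublevel_integral S \<phi> (exp (- (T * g)))"
        by (rule elim(1)[rule_format]) (use C elim(2) in auto)
      moreover have "exp (- (T *\<^sub>R w0 \<bullet> ?v) / d) * exp (T *\<^sub>R w0 \<bullet> ?v - T * g) powr a = exp (- (T * g)) powr a1"
      proof -
        have "g * a1 = b / d + a * (\<eta> / 4)" using g by (simp add: a1_def)
        then have "- (T * g) * a1 = - (T * (b / d + a * (\<eta> / 4)))" by (simp only: mult.assoc mult_minus_left)
        also have "\<dots> = - (T * b) / d + (T * b - T * g) * a" by (simp add: g_def algebra_simps)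
        finally have "- (T * g) * a1 = - (T * b) / d + (T * b - T * g) * a" .
        moreover have "T *\<^sub>R w0 \<bullet> ?v = T * b" using w0(2)[OF vF] by simp
        ultimately show ?thesis by (simp only: exp_powr_real exp_add)
      qed
      moreover have "C * 1 * exp (- (T * g)) powr a1 \<le> C * T ^ q * exp (- (T * g)) powr a1"
        using C(1) elim(2) by (intro mult_right_mono mult_left_mono one_le_power) auto
      ultimately show ?case by simp
    qed
    with lim have "\<forall>\<^sub>F \<epsilon> in at_right 0. C * exp (- (- ln \<epsilon> / g * g)) powr a1
        \<le> abs_sublevel_integral S \<phi> (exp (- (- ln \<epsilon> / g * g)))"
      by (rule eventually_compose_filterlim[rotated])
    then have "\<forall>\<^sub>F \<epsilon> in at_right 0. C / 2 * \<epsilon> powr a1 < abs_sublevel_integral S \<phi> \<epsilon>"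
      using eventually_at_right_less[of 0]
    proof eventually_elim
      case (elim \<epsilon>)
      \<comment> \<open>Halving the constant makes the inequality strict.\<close>
      have "C / 2 * \<epsilon> powr a1 < C * \<epsilon> powr a1"
        using C(1) elim(2) by (intro mult_strict_right_mono) auto
      moreover have "exp (- (- ln \<epsilon> / g * g)) = \<epsilon>" using g elim(2) by simp
      ultimately show ?case using elim(1) by (simp only:)
    qed
    with a1 C(1) show "\<exists>a'<1 / d. \<exists>C>0. \<forall>\<^sub>F \<epsilon> in at_right 0. C * \<epsilon> powr a' < abs_sublevel_integral S \<phi> \<epsilon>"
      by (intro exI[of _ a1] conjI exI[of _ "C / 2"]) auto
  next
    fix \<phi> :: "real ^ 'n \<Rightarrow> real" and q assume \<phi>: "\<phi> \<in> bump_functions (ball 0 R)"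
    assume "\<exists>x. (\<forall>i. x $ i \<noteq> 0) \<and> abs_has_growth_index_at (face_poly s F) x (ereal (1 / d)) q"
    then obtain x where x: "\<And>i. x $ i \<noteq> 0" "abs_has_growth_index_at (face_poly s F) x (ereal (1 / d)) q"
      by blast
    obtain C r where C: "0 < C" "0 < r" and ev: "\<forall>\<^sub>F T in at_top. \<forall>W. finite W \<longrightarrow>
       (\<forall>w\<in>W. norm (w - T *\<^sub>R w0) \<le> r * T \<and> (\<forall>z\<in>F. (w - T *\<^sub>R w0) \<bullet> (z - ?v) = 0)) \<longrightarrow>
       (\<forall>w\<in>W. \<forall>w'\<in>W. w \<noteq> w' \<longrightarrow> (\<exists>i. 2 \<le> \<bar>w $ i - w' $ i\<bar>)) \<longrightarrow>
       C * T ^ q * (\<Sum>w\<in>W. exp (- (w \<bullet> ?v) / d) * exp (w \<bullet> ?v - T * g) powr (1 / d))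
         \<le> abs_sublevel_integral S \<phi> (exp (- (T * g)))"
      using bound[OF \<phi> x] by blast
    define E where "E = {u. \<forall>z\<in>F. u \<bullet> (z - ?v) = 0}"
    define e where "e = CARD('n) - k"
    have E: "subspace E" "dim E = e"
      using dim_orthogonal_to_directions[OF vF assms(10)] by (simp_all add: E_def e_def)
    define c where "c = r / (2 * real CARD('n) ^ 2)"
    have c: "0 < c" using C(2) by (simp add: c_def)
    have "\<forall>\<^sub>F T in at_top. C * c ^ e * T ^ (e + q) * exp (- (T * g)) powr (1 / d)
        \<le> abs_sublevel_integral S \<phi> (exp (- (T * g)))"
      using ev eventually_ge_at_top[of 0]
    proof eventually_elim
      case (elim T)
      obtain W where W: "finite W" "W \<subseteq> E" "\<And>w. w \<in> W \<Longrightarrow> norm w \<le> r * T"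
        and sep: "\<And>w w'. w \<in> W \<Longrightarrow> w' \<in> W \<Longrightarrow> w \<noteq> w' \<Longrightarrow> \<exists>i. 2 \<le> \<bar>w $ i - w' $ i\<bar>"
        and card: "(r * T / (2 * real CARD('n) ^ 2)) ^ dim E \<le> real (card W)"
        using separated_points_in_subspace[OF E(1), of "r * T"] C(2) elim(2) by auto
      let ?W = "(\<lambda>u. T *\<^sub>R w0 + u) ` W"
      have "C * T ^ q * (\<Sum>w\<in>?W. exp (- (w \<bullet> ?v) / d) * exp (w \<bullet> ?v - T * g) powr (1 / d))
         \<le> abs_sublevel_integral S \<phi> (exp (- (T * g)))"
        by (rule elim(1)[rule_format]) (use W sep in \<open>auto simp: E_def\<close>)
      \<comment> \<open>For the index 1/d the two occurrences of \<open>w\<close> cancel: all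
        weights contribute equally, and only their number matters.\<close>
      moreover have "exp (- (w \<bullet> ?v) / d) * exp (w \<bullet> ?v - T * g) powr (1 / d) = exp (- (T * g)) powr (1 / d)" for w
        by (simp add: powr_def diff_divide_distrib flip: exp_add)
      moreover have "card ?W = card W" by (intro card_image) simp
      ultimately have "C * T ^ q * (real (card W) * exp (- (T * g)) powr (1 / d))
         \<le> abs_sublevel_integral S \<phi> (exp (- (T * g)))" by simp
      moreover have "C * T ^ q * ((c * T) ^ e * exp (- (T * g)) powr (1 / d))
          \<le> C * T ^ q * (real (card W) * exp (- (T * g)) powr (1 / d))"
        using card E(2) C(1) elim(2) by (intro mult_left_mono mult_right_mono) (auto simp: c_def)
      ultimately show ?case by (simp add: power_add power_mult_distrib mult_ac)
    qed
    with lim have "\<forall>\<^sub>F \<epsilon> in at_right 0. C * c ^ e * (- ln \<epsilon> / g) ^ (e + q) * exp (- (- ln \<epsilon> / g * g)) powr (1 / d)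
        \<le> abs_sublevel_integral S \<phi> (exp (- (- ln \<epsilon> / g * g)))"
      by (rule eventually_compose_filterlim[rotated])
    \<comment> \<open>The power of \<open>g\<close> comes from T = |ln \<epsilon>| / g: the exponent
      \<open>e\<close> counts weights and \<open>q\<close> is the multiplicity.\<close>
    then have "\<forall>\<^sub>F \<epsilon> in at_right 0. C * c ^ e / g ^ (e + q) / 2 * \<bar>ln \<epsilon>\<bar> ^ (e + q) * \<epsilon> powr (1 / d)
        < abs_sublevel_integral S \<phi> \<epsilon>"
      using eventually_at_right_real[OF zero_less_one]
    proof eventually_elim
      case (elim \<epsilon>)
      then have \<epsilon>: "0 < \<epsilon>" "ln \<epsilon> < 0" by auto
      have "0 < C * c ^ e / g ^ (e + q) * \<bar>ln \<epsilon>\<bar> ^ (e + q) * \<epsilon> powr (1 / d)"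
        using C(1) c g \<epsilon> by simp
      moreover have "exp (- (- ln \<epsilon> / g * g)) = \<epsilon>" using g \<epsilon> by simp
      moreover have "C * c ^ e * (- ln \<epsilon> / g) ^ (e + q) = C * c ^ e / g ^ (e + q) * \<bar>ln \<epsilon>\<bar> ^ (e + q)"
        using \<epsilon>(2) by (simp only: abs_of_neg power_divide times_divide_eq_right times_divide_eq_left)
      ultimately show ?case using elim(1) by simp
    qed
    moreover have "0 < C * c ^ e / g ^ (e + q) / 2" using C(1) c g by simp
    ultimately show "\<exists>C>0. \<forall>\<^sub>F \<epsilon> in at_right 0.
        C * \<bar>ln \<epsilon>\<bar> ^ (CARD('n) - k + q) * \<epsilon> powr (1 / d) < abs_sublevel_integral S \<phi> \<epsilon>"
      unfolding e_def by blast
  qed simp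
qed

end
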